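(* Let $\mathbf v$ be a complementary symmetric Rote sequence associated with the standard Sturmian sequence $\mathbf u=\mathcal S(\mathbf v)$. If $\mathrm{cr}(\mathbf v)\le3$, then the directive sequence of $\mathbf u$ is of one of the following forms: 1. $G^{a_1}(D^2G^2)^\omega$, where $a_1=1$ or $a_1=3$; in this case $\mathrm{cr}(\mathbf v)=2+\tfrac1{\sqrt2}$; 2. $G^{a_1}D^4(G^2D^2)^\omega$, where $a_1=1$ or $a_1=3$; in this case $\mathrm{cr}(\mathbf v)=3$; 3. $G^{a_1}D^1G^{a_3}(D^2G^2)^\omega$, where $a_1=2$ or $a_1=4$, and $a_3=1$ or $a_3=3$; in this case $\mathrm{cr}(\mathbf v)=3$; 4. $D^1G^{a_2}(D^2G^2)^\omega$, where $a_2=1$ or $a_2=3$; in this case $\mathrm{cr}(\mathbf v)=3$.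
   Context: $\mathbb N=\{0,1,2,\dots\}$. Sequences are right-infinite words; $\mathcal L(\mathbf u)$ is the set of finite factors of $\mathbf u$; $x^\omega=xxx\cdots$. A word $z$ equals $u^e$ (with $u$ non-empty, $e=|z|/|u|$) if $z$ is a prefix of $u^\omega$. For a non-empty factor $u$ of $\mathbf u$, $\mathrm{ind}_{\mathbf u}(u)=\sup\{e\in\mathbb Q:u^e\in\mathcal L(\mathbf u)\}$, and $\mathrm{cr}(\mathbf u)=\sup\{\mathrm{ind}_{\mathbf u}(u):u\text{ a non-empty factor of }\mathbf u\}$. A Rote sequence is a binary sequence having exactly $2n$ factors of length $n$ for every $n\ge1$. It is complementary symmetric (CS) if its language is closed under the exchange of letters $0\leftrightarrow1$. For a binary sequence $\mathbf v=v_0v_1\cdots$, $\mathcal S(\mathbf v)=u_0u_1\cdots$ with $u_i=v_i+v_{i+1}\bmod2$. A Sturmian sequence (over $\{0,1\}$) has exactly $n+1$ factors of length $n$ for every $n\in\mathbb N$; it is standard if both $0\mathbf u$ and $1\mathbf u$ are Sturmian. Known fact: $\mathbf v$ is CS Rote iff $\mathcal S(\mathbf v)$ is Sturmian. Directive sequence: let $G:0\mapsto10,\ 1\mapsto1$ and $D:0\mapsto0,\ 1\mapsto01$. For every standard Sturmian $\mathbf u$ there is a unique sequence $\Delta_0\Delta_1\Delta_2\cdots\in\{G,D\}^{\mathbb N}$ (the directive sequence of $\mathbf u$) for which there are standard Sturmian sequences $\mathbf u^{(n)}$ with $\mathbf u=\Delta_0\Delta_1\cdots\Delta_{n-1}(\mathbf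 u^{(n)})$ for all $n\in\mathbb N$. *)

theory Defs
  imports
    "HOL-Library.Omega_Words_Fun"
    "HOL-Library.Z2"
    "HOL-Library.Extended_Real"
begin

definition language :: "'a word \<Rightarrow> 'a list set" where
  "language w = {w [i \<rightarrow> j] | i j. i \<le> j}"

definition factors :: "'a word \<Rightarrow> nat \<Rightarrow> 'a list set" where
  "factors w n = {z \<in> language w. length z = n}"

text \<open>\<open>frac_power u e z\<close> means that \<open>z = u\<^sup>e\<close>.\<close>

definition frac_power :: "'a list \<Rightarrow> rat \<Rightarrow> 'a list \<Rightarrow> bool" where
  "frac_power u e z \<longleftrightarrow>
     u \<noteq> [] \<and> e = of_nat (length z) / of_nat (length u) \<and> z = prefix (length z) (u\<^sup>\<omega>)"

text \<open>The index and the critical exponent may be infinite, hence the extended reals.\<close>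

definition ind :: "'a word \<Rightarrow> 'a list \<Rightarrow> ereal" where
  "ind w u = Sup {ereal (real_of_rat e) | e z. frac_power u e z \<and> z \<in> language w}"

definition cr :: "'a word \<Rightarrow> ereal" where
  "cr w = Sup {ind w u | u. u \<in> language w \<and> u \<noteq> []}"

text \<open>
  Binary sequences are words over the type \<^typ>\<open>bit\<close>, whose addition is addition modulo 2;
  in particular \<open>b + 1\<close> is the complement of \<open>b\<close>.
\<close>

definition rote :: "bit word \<Rightarrow> bool" where
  "rote v \<longleftrightarrow> (\<forall>n\<ge>1. card (factors v n) = 2 * n)"

definition cs_rote :: "bit word \<Rightarrow> bool" where
  "cs_rote v \<longleftrightarrow> rote v \<and> (\<forall>z \<in> language v. map (\<lambda>b. b + 1) z \<in> language v)"

definition S :: "bit word \<Rightarrow> bit word" where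
  "S v = (\<lambda>i. v i + v (i + 1))"

definition sturmian :: "bit word \<Rightarrow> bool" where
  "sturmian u \<longleftrightarrow> (\<forall>n. card (factors u n) = n + 1)"

definition standard_sturmian :: "bit word \<Rightarrow> bool" where
  "standard_sturmian u \<longleftrightarrow> sturmian u \<and> sturmian ([0] \<frown> u) \<and> sturmian ([1] \<frown> u)"

datatype morphism = G | D

primrec letter_image :: "morphism \<Rightarrow> bit \<Rightarrow> bit list" where
  "letter_image G b = (if b = 0 then [1, 0] else [1])"
| "letter_image D b = (if b = 0 then [0] else [0, 1])"

text \<open>
  Images of letters are non-empty, so the image of the prefix of length \<open>n + 1\<close> has
  length at least \<open>n + 1\<close> and determines position \<open>n\<close> of the image of the whole sequence.
\<close>

definition apply_morphism :: "morphism \<Rightarrow> bit word \<Rightarrow> bit word" where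
  "apply_morphism \<phi> w = (\<lambda>n. concat (map (letter_image \<phi>) (prefix (n + 1) w)) ! n)"

text \<open>
  The right fold applies \<open>\<Delta> (n - 1)\<close> first and \<open>\<Delta> 0\<close> last. The directive sequence of a
  standard Sturmian sequence exists and is unique, so it is represented by its defining relation.
\<close>

definition directive_sequence :: "morphism word \<Rightarrow> bit word \<Rightarrow> bool" where
  "directive_sequence \<Delta> u \<longleftrightarrow>
     (\<exists>U. \<forall>n. standard_sturmian (U n) \<and> u = foldr apply_morphism (prefix n \<Delta>) (U n))"

end

theory Submission
  imports Defs "HOL-Library.Multiset"
begin

text \<open>
  A repetition of period \<open>p\<close> and length \<open>p + m + 1\<close> in \<open>v\<close> is the same thing as a factor of
  length \<open>m\<close> of \<open>u = S v\<close> recurring at distance \<open>p\<close>, with an even number of ones in between.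
  Such a pair of occurrences in \<open>\<phi>(u')\<close> comes from one in \<open>u'\<close>: if \<open>r\<close> is the maximal match in
  \<open>u'\<close>, then \<open>\<phi>(r)\<close> followed by the common first letter of the images is the maximal match in
  \<open>\<phi>(u')\<close>. Descending along the directive sequence until the match is empty, after \<open>n\<close> steps,
  gives \<open>m + 2 \<le> s + t\<close>, where \<open>s\<close> and \<open>t\<close> are the lengths of the images of \<open>0\<close> and \<open>1\<close>
  under \<open>\<Delta>\<^sub>0 \<dots> \<Delta>\<^sub>n\<^sub>-\<^sub>1\<close>, while \<open>p\<close> is the length of the image of a
  non-empty factor of \<open>u\<^sup>(\<^sup>n\<^sup>)\<close>. Only the factors \<open>0\<close>, \<open>1\<close>, \<open>00\<close>, \<open>11\<close> can then push the exponent
  above \<open>2\<close>, and \<open>00\<close> occurs iff \<open>\<Delta>\<^sub>n = D\<close>, \<open>11\<close> iff \<open>\<Delta>\<^sub>n = G\<close>. So the critical exponent is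
  bounded by \<open>1 + c\<close> iff \<open>s + t - 1\<close> is at most \<open>c\<close> times the length of each of their images
  with an even number of ones. For \<open>c = 2\<close> these inequalities leave only the listed directive
  sequences, and along the periodic part \<open>s\<^sup>2 - 2 s t - t\<^sup>2\<close> is invariant, which yields the limit
  \<open>s / (s + t) \<rightarrow> 1 / \<surd>2\<close>.
\<close>

section \<open>The morphisms on finite and infinite words\<close>

primrec first_letter :: "morphism \<Rightarrow> bit" where
  "first_letter G = 1"
| "first_letter D = 0"

abbreviation morph :: "morphism \<Rightarrow> bit list \<Rightarrow> bit list" where
  "morph \<phi> xs \<equiv> concat (map (letter_image \<phi>) xs)"

lemma letter_image_eq:
  "letter_image \<phi> b = (if b = first_letter \<phi> then [b] else [first_letter \<phi>, b])"
  by (cases \<phi>) auto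

lemma length_morph_ge: "length xs \<le> length (morph \<phi> xs)"
proof (induction xs)
  case (Cons a xs)
  have "length (letter_image \<phi> a) \<ge> 1"
    by (simp add: letter_image_eq)
  with Cons show ?case
    by simp
qed simp

text \<open>Images of nested prefixes are nested, so any prefix whose image reaches past
  \<open>n\<close> may replace the one of length \<open>n + 1\<close> fixed in the
  definition.\<close>

lemma apply_morphism_nth:
  assumes "n < length (morph \<phi> (prefix k w))"
  shows "apply_morphism \<phi> w n = morph \<phi> (prefix k w) ! n"
proof -
  have mono: "morph \<phi> (prefix l w) ! n = morph \<phi> (prefix m w) ! n"
    if "l \<le> m" "n < length (morph \<phi> (prefix l w))" for l m
  proof -
    have "prefix m w = prefix l w @ (w [l \<rightarrow> m])"
      using subsequence_append[of w l "m - l"] that by simp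
    with that show ?thesis
      by (simp add: nth_append)
  qed
  have "n < length (morph \<phi> (prefix (n + 1) w))"
    using length_morph_ge[of "prefix (n + 1) w" \<phi>] by simp
  with assms mono[of k "n + 1"] mono[of "n + 1" k] show ?thesis
    by (cases "k \<le> n + 1") (auto simp: apply_morphism_def)
qed

lemma apply_morphism_conc:
  "apply_morphism \<phi> (xs \<frown> w) = morph \<phi> xs \<frown> apply_morphism \<phi> w"
proof
  fix n
  let ?k = "length xs + n + 1"
  have p: "prefix ?k (xs \<frown> w) = xs @ prefix (n + 1) w"
    by simp
  have l: "n < length (morph \<phi> (prefix (n + 1) w))"
    using length_morph_ge[of "prefix (n + 1) w" \<phi>] by simp
  have "apply_morphism \<phi> (xs \<frown> w) n = morph \<phi> (prefix ?k (xs \<frown> w)) ! n"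
    by (rule apply_morphism_nth) (use p l in simp)
  also have "\<dots> = (morph \<phi> xs \<frown> apply_morphism \<phi> w) n"
  proof (cases "n < length (morph \<phi> xs)")
    case True
    then show ?thesis
      unfolding p by (simp add: nth_append)
  next
    case False
    have "apply_morphism \<phi> w (n - length (morph \<phi> xs))
        = morph \<phi> (prefix (n + 1) w) ! (n - length (morph \<phi> xs))"
      by (rule apply_morphism_nth) (use l in simp)
    with False show ?thesis
      unfolding p map_append concat_append by (simp add: nth_append)
  qed
  finally show "apply_morphism \<phi> (xs \<frown> w) n = (morph \<phi> xs \<frown> apply_morphism \<phi> w) n" .
qed

lemma apply_morphism_unfold:
  "apply_morphism \<phi> w = letter_image \<phi> (w 0) \<frown> apply_morphism \<phi> (suffix 1 w)"
  using apply_morphism_conc[of \<phi> "[w 0]" "suffix 1 w"] by simp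

lemma apply_morphism_first:
  "apply_morphism \<phi> w = [first_letter \<phi>] \<frown> suffix 1 (apply_morphism \<phi> w)"
proof -
  have "apply_morphism \<phi> w 0 = first_letter \<phi>"
    by (subst apply_morphism_unfold) (simp add: letter_image_eq)
  then show ?thesis
    by (metis One_nat_def build_cons build_first conc_empty)
qed

text \<open>Every block \<open>letter_image \<phi> e\<close> starts with the first letter and
  contains it nowhere else, so each occurrence of that letter marks a block boundary and the image
  can be cut there.\<close>

lemma morph_split_first:
  assumes "morph \<phi> b = a @ first_letter \<phi> # x"
  obtains a' x' where "b = a' @ x'" "a = morph \<phi> a'" "first_letter \<phi> # x = morph \<phi> x'"
  using assms
proof (induction b arbitrary: a thesis)
  case (Cons e b)
  show ?case
  proof (cases "a = []")
    case True
    with Cons.prems(2) show ?thesis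
      by (intro Cons.prems(1)[of "[]" "e # b"]) auto
  next
    case False
    then obtain a1 where a: "a = letter_image \<phi> e @ a1" and "morph \<phi> b = a1 @ first_letter \<phi> # x"
      using Cons.prems(2) by (fastforce simp: letter_image_eq[of \<phi> e] Cons_eq_append_conv split: if_splits)
    from Cons.IH[OF _ this(2)] obtain a' x'
      where "b = a' @ x'" "a1 = morph \<phi> a'" "first_letter \<phi> # x = morph \<phi> x'"
      by blast
    with a show ?thesis
      by (intro Cons.prems(1)[of "e # a'" x']) auto
  qed
qed simp

text \<open>The other letter occurs only as the second letter of a two-letter block.\<close>

lemma morph_split_other:
  assumes "morph \<phi> b = a @ d # x" "d \<noteq> first_letter \<phi>"
  shows "\<exists>a0. a = a0 @ [first_letter \<phi>]"
  using assms
proof (induction b arbitrary: a)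
  case (Cons e b)
  show ?case
  proof (cases "\<exists>a1. a = letter_image \<phi> e @ a1 \<and> morph \<phi> b = a1 @ d # x")
    case True
    then obtain a1 where a: "a = letter_image \<phi> e @ a1" and "morph \<phi> b = a1 @ d # x"
      by blast
    with Cons show ?thesis
      by fastforce
  next
    case False
    with Cons.prems show ?thesis
      by (auto simp: letter_image_eq[of \<phi> e] Cons_eq_append_conv split: if_splits)
  qed
qed simp

text \<open>Transfers a cut of the infinite image to a finite one: the first
  \<open>length a + 1\<close> letters of \<open>w\<close> have an image long enough to contain
  \<open>a\<close> and the letter after it.\<close>

lemma apply_morphism_split_list:
  assumes "apply_morphism \<phi> w = a \<frown> y"
  obtains b x where "morph \<phi> b = a @ y 0 # x" "w = b \<frown> suffix (length b) w"
proof -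
  define b where "b = prefix (length a + 1) w"
  have b: "w = b \<frown> suffix (length b) w" "length b = length a + 1"
    by (simp_all add: b_def)
  have "length a + 1 \<le> length (morph \<phi> b)"
    using length_morph_ge[of b \<phi>] b(2) by simp
  moreover have "a \<frown> y = morph \<phi> b \<frown> apply_morphism \<phi> (suffix (length b) w)"
    using assms b(1) apply_morphism_conc by metis
  from this have "prefix (length (morph \<phi> b)) (a \<frown> y) = morph \<phi> b"
    by simp
  moreover from calculation have
    "prefix (length (morph \<phi> b)) (a \<frown> y) = a @ prefix (length (morph \<phi> b) - length a) y"
    by (intro prefix_conc_snd) simp
  ultimately have "morph \<phi> b = a @ prefix (length (morph \<phi> b) - length a) y"
    "length (morph \<phi> b) - length a \<ge> 1"
    by auto
  then have "morph \<phi> b = a @ y 0 # y [1 \<rightarrow> length (morph \<phi> b) - length a]"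
    by (metis One_nat_def Suc_le_lessD subsequence_def upt_conv_Cons list.simps(9))
  then show thesis
    using b(1) that by blast
qed

lemma apply_morphism_split:
  assumes "apply_morphism \<phi> w = a \<frown> y" "y 0 = first_letter \<phi>"
  obtains a' y' where "w = a' \<frown> y'" "a = morph \<phi> a'" "y = apply_morphism \<phi> y'"
proof -
  obtain b x where b: "morph \<phi> b = a @ first_letter \<phi> # x" "w = b \<frown> suffix (length b) w"
    using apply_morphism_split_list[OF assms(1)] assms(2) by metis
  obtain a' x' where a': "b = a' @ x'" "a = morph \<phi> a'"
    by (rule morph_split_first[OF b(1)])
  have w: "w = a' \<frown> (x' \<frown> suffix (length b) w)"
    using b(2) a'(1) by simp
  then have "a \<frown> y = a \<frown> apply_morphism \<phi> (x' \<frown> suffix (length b) w)"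
    using assms(1) apply_morphism_conc a'(2) by metis
  then have "y = apply_morphism \<phi> (x' \<frown> suffix (length b) w)"
    by (simp only: same_concat_eq)
  with w a'(2) show thesis
    by (rule that)
qed

text \<open>Common first letters are stripped off one by one. Once the remaining letters differ, the
  two images agree only in the first letter of a block, which accounts for the single extra letter
  in the conclusion.\<close>

lemma apply_morphism_common_prefix:
  assumes "apply_morphism \<phi> y1 = r \<frown> z1" "apply_morphism \<phi> y2 = r \<frown> z2"
  obtains r' t z1' z2' where "y1 = r' \<frown> z1'" "y2 = r' \<frown> z2'"
    "morph \<phi> r' @ [first_letter \<phi>] = r @ t"
  using assms
proof (induction "length r" arbitrary: r y1 y2 thesis rule: less_induct)
  case less
  let ?c = "first_letter \<phi>"
  have y: "y1 = [y1 0] \<frown> suffix 1 y1" "y2 = [y2 0] \<frown> suffix 1 y2"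
    by simp_all
  have u1: "r \<frown> z1 = letter_image \<phi> (y1 0) \<frown> apply_morphism \<phi> (suffix 1 y1)"
    and u2: "r \<frown> z2 = letter_image \<phi> (y2 0) \<frown> apply_morphism \<phi> (suffix 1 y2)"
    using less.prems(2,3) apply_morphism_unfold by metis+
  show ?case
  proof (cases "y1 0 = y2 0")
    case False
    have "length r \<le> 1"
    proof (rule ccontr)
      assume "\<not> ?thesis"
      then have r: "(r \<frown> z1) 1 = (r \<frown> z2) 1"
        by simp
      have c: "apply_morphism \<phi> w 0 = ?c" for w
        by (subst apply_morphism_first) simp
      \<comment> \<open>Position 1 tells the two letters apart: a one-letter block is followed by
        the start of the next block, again \<open>?c\<close>, while a two-letter block shows its
        other letter.\<close>
      have *: "(letter_image \<phi> e \<frown> apply_morphism \<phi> w) 1 = (if e = ?c then ?c else e)" for e w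
        using c by (simp add: letter_image_eq)
      have "y1 0 = ?c \<or> y2 0 = ?c"
        using False by (metis bit_not_one_iff)
      with r False show False
        unfolding u1 u2 * by (auto split: if_splits)
    qed
    moreover have "r = [?c]" if "length r = 1"
    proof -
      have "(r \<frown> z1) 0 = ?c"
        unfolding less.prems(2)[symmetric] by (subst apply_morphism_first) simp
      with that show ?thesis
        by (cases r) auto
    qed
    ultimately have "r = [] \<or> r = [?c]"
      by (cases r) auto
    then show ?thesis
      by (intro less.prems(1)[of "[]" y1 y2 "if r = [] then [?c] else []"]) auto
  next
    case True
    let ?I = "letter_image \<phi> (y1 0)"
    show ?thesis
    proof (cases "length r \<le> length ?I")
      case True
      have "r = take (length r) ?I"
        using arg_cong[OF u1, of "prefix (length r)"] True by simp
      then have "?I = r @ drop (length r) ?I"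
        by (metis append_take_drop_id)
      then have "morph \<phi> [y1 0] @ [?c] = r @ (drop (length r) ?I @ [?c])"
        by (metis append.assoc append.right_neutral concat.simps list.map)
      then show ?thesis
        using y \<open>y1 0 = y2 0\<close> less.prems(1) by metis
    next
      case False
      define r1 where "r1 = drop (length ?I) r"
      have "?I = take (length ?I) r"
        using arg_cong[OF u1, of "prefix (length ?I)"] False by simp
      then have r: "r = ?I @ r1"
        unfolding r1_def by (metis append_take_drop_id)
      have "?I \<noteq> []"
        by (simp add: letter_image_eq)
      then have "length r1 < length r"
        using r by simp
      moreover have "apply_morphism \<phi> (suffix 1 y1) = r1 \<frown> z1"
        using u1 unfolding r by (metis conc_conc same_concat_eq)
      moreover have "apply_morphism \<phi> (suffix 1 y2) = r1 \<frown> z2"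
        using u2 True unfolding r by (metis conc_conc same_concat_eq)
      ultimately obtain r' t z1' z2' where r': "suffix 1 y1 = r' \<frown> z1'" "suffix 1 y2 = r' \<frown> z2'"
        "morph \<phi> r' @ [?c] = r1 @ t"
        using less.hyps by metis
      have "y1 = (y1 0 # r') \<frown> z1'" "y2 = (y1 0 # r') \<frown> z2'"
        using y r'(1,2) True by (metis append_Cons append_Nil conc_conc)+
      then show ?thesis
        using r'(3) r by (intro less.prems(1)[of "y1 0 # r'" z1' z2' t]) auto
    qed
  qed
qed

section \<open>Repetitions under desubstitution and substitution\<close>

lemma mset_morph_cong:
  assumes "mset xs = mset ys"
  shows "mset (morph \<phi> xs) = mset (morph \<phi> ys)"
  using arg_cong[OF assms, of "\<lambda>A. \<Sum>\<^sub># (image_mset (mset \<circ> letter_image \<phi>) A)"]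
  by (simp add: mset_concat sum_mset_sum_list[symmetric] comp_def)

text \<open>The bookkeeping identity: when a match \<open>r\<close> grows to
  \<open>morph \<phi> r @ [first_letter \<phi>]\<close>, adjoining \<open>0, 1\<close> gives, up to
  order, the image of \<open>r @ [0, 1]\<close>.\<close>

lemma mset_morph_letters: "mset (morph \<phi> [0, 1]) = mset [0, 1, first_letter \<phi>]"
  by (cases \<phi>) auto

text \<open>If the match \<open>r\<close> starts with the first letter of the blocks, both
  occurrences start at block boundaries and everything can be desubstituted. Otherwise both are
  preceded by that letter and the pair is moved one place to the left. This replaces
  \<open>x\<close> by a conjugate, which is why words are compared only as multisets: lengths and
  numbers of ones survive.\<close>

lemma descend_step:
  assumes w: "apply_morphism \<phi> w = a \<frown> (x \<frown> y)" "x \<noteq> []"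
    and r: "x \<frown> y = r \<frown> z1" "y = r \<frown> z2" "r \<noteq> []"
  obtains a' x' y' r' z1' z2' t where "w = a' \<frown> (x' \<frown> y')" "x' \<noteq> []"
    "x' \<frown> y' = r' \<frown> z1'" "y' = r' \<frown> z2'"
    "mset x = mset (morph \<phi> x')" "mset (morph \<phi> r' @ [first_letter \<phi>]) = mset (r @ t)"
proof -
  let ?c = "first_letter \<phi>"
  \<comment> \<open>The case of a match at block boundaries. \<open>x0\<close> and \<open>r0\<close>
    stand for the original words, from which \<open>x\<close> and \<open>r\<close> may differ by a
    move to the left; \<open>t0\<close> collects the letters added to the match.\<close>
  have *: thesis
    if w: "apply_morphism \<phi> w = a \<frown> (x \<frown> y)" "x \<noteq> []" "mset x = mset x0"
      and r: "x \<frown> y = r \<frown> z1" "y = r \<frown> z2" "r \<noteq> []" "hd r = ?c" "mset r = mset (r0 @ t0)"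
      and that: "\<And>a' x' y' r' z1' z2' t. \<lbrakk>w = a' \<frown> (x' \<frown> y'); x' \<noteq> [];
        x' \<frown> y' = r' \<frown> z1'; y' = r' \<frown> z2'; mset x0 = mset (morph \<phi> x');
        mset (morph \<phi> r' @ [?c]) = mset (r0 @ t)\<rbrakk> \<Longrightarrow> thesis"
    for a x y r z1 z2 x0 r0 t0 thesis
  proof -
    have "y 0 = ?c" "(x \<frown> y) 0 = ?c"
      using conc_fst[of 0 r z1] conc_fst[of 0 r z2] r by (auto simp: hd_conv_nth)
    moreover obtain b y' where b: "w = b \<frown> y'" "a @ x = morph \<phi> b" "y = apply_morphism \<phi> y'"
      using apply_morphism_split[of \<phi> w "a @ x" y] w(1) \<open>y 0 = ?c\<close> by auto
    moreover obtain x2 where x2: "x = ?c # x2"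
      using \<open>(x \<frown> y) 0 = ?c\<close> w(2) by (cases x) auto
    ultimately obtain a' x' where x': "b = a' @ x'" "x = morph \<phi> x'"
      using morph_split_first by metis
    have "apply_morphism \<phi> (x' \<frown> y') = r \<frown> z1"
      unfolding apply_morphism_conc using r(1) x'(2) b(3) by simp
    moreover have "apply_morphism \<phi> y' = r \<frown> z2"
      using b(3) r(2) by simp
    ultimately obtain r' t z1' z2'
      where "x' \<frown> y' = r' \<frown> z1'" "y' = r' \<frown> z2'" and t: "morph \<phi> r' @ [?c] = r @ t"
      using apply_morphism_common_prefix by metis
    moreover have "w = a' \<frown> (x' \<frown> y')" "x' \<noteq> []"
      using b(1) x' w(2) by auto
    moreover have "mset (morph \<phi> r' @ [?c]) = mset (r0 @ (t0 @ t))"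
      unfolding t using r(5) by simp
    ultimately show thesis
      using that x'(2) w(3) by metis
  qed
  show thesis
  proof (cases "hd r = ?c")
    case True
    show thesis
      by (rule *[OF w refl r True, where ?r0.0 = r and ?t0.0 = "[]"]) (simp, rule that)
  next
    case False
    have heads: "y 0 = hd r" "(x \<frown> y) 0 = hd r"
      using conc_fst[of 0 r z1] conc_fst[of 0 r z2] r by (auto simp: hd_conv_nth)
    have "apply_morphism \<phi> w = (a @ x) \<frown> y"
      using w(1) by simp
    then obtain b1 t1 where "morph \<phi> b1 = (a @ x) @ hd r # t1"
      using apply_morphism_split_list heads(1) by metis
    then obtain q where "a @ x = q @ [?c]"
      using morph_split_other False by blast
    then obtain x1 where x1: "x = x1 @ [?c]"
      using w(2) by (metis append_butlast_last_id last_appendR last_snoc)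
    obtain b2 t2 where "morph \<phi> b2 = a @ hd r # t2"
      using apply_morphism_split_list[of \<phi> w a "x \<frown> y"] w(1) heads by metis
    then obtain a1 where a1: "a = a1 @ [?c]"
      using morph_split_other False by blast
    \<comment> \<open>Both occurrences move to the left by the letter \<open>?c\<close>:
      \<open>x1 @ [?c]\<close> becomes \<open>?c # x1\<close> and the match becomes
      \<open>?c # r\<close>.\<close>
    have split: "apply_morphism \<phi> w = a1 \<frown> ((?c # x1) \<frown> ([?c] \<frown> y))"
      using w(1) x1 a1 by simp
    have r1: "(?c # x1) \<frown> ([?c] \<frown> y) = (?c # r) \<frown> z1"
      using r(1) unfolding x1 by simp
    have r2: "[?c] \<frown> y = (?c # r) \<frown> z2"
      using r(2) by simp
    show thesis
      by (rule *[OF split _ _ r1 r2, where ?x0.0 = x and ?r0.0 = r and ?t0.0 = "[?c]"])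
        (simp add: x1, simp add: x1, simp, simp, simp, rule that)
  qed
qed

abbreviation morphs :: "morphism list \<Rightarrow> bit list \<Rightarrow> bit list" where
  "morphs \<equiv> foldr morph"

lemma morphs_Nil: "morphs ds [] = []"
  by (induction ds) auto

lemma morphs_append: "morphs ds (xs @ ys) = morphs ds xs @ morphs ds ys"
  by (induction ds) auto

lemma length_morphs_ge: "length xs \<le> length (morphs ds xs)"
  by (induction ds) (auto intro: order_trans[OF _ length_morph_ge])

text \<open>Desubstitution is repeated until the match is empty or the morphisms are used up. The
  inequality \<open>length r + 2 \<le> length (morphs ds1 [0, 1])\<close> is carried as an inclusion
  of multisets, trivial for the empty match. When the morphisms run out first, nothing is claimed
  about \<open>r\<close>.\<close>

lemma descend:
  assumes "foldr apply_morphism ds w = a \<frown> (x \<frown> y)" "x \<noteq> []"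
    and "x \<frown> y = r \<frown> z1" "y = r \<frown> z2"
  shows "\<exists>ds1 ds2 x'. ds = ds1 @ ds2 \<and> x' \<noteq> [] \<and> mset x = mset (morphs ds1 x') \<and>
    (ds2 = [] \<or> (\<exists>a' y'. foldr apply_morphism ds2 w = a' \<frown> (x' \<frown> y')) \<and>
                (\<exists>t. mset (morphs ds1 [0, 1]) = mset (r @ [0, 1] @ t)))"
  using assms
proof (induction ds arbitrary: a x y r z1 z2)
  case Nil
  then show ?case
    by auto
next
  case (Cons \<phi> ds)
  show ?case
  proof (cases "r = []")
    case True
    with Cons.prems show ?thesis
      by - (rule exI[of _ "[]"], rule exI[of _ "\<phi> # ds"], rule exI[of _ x], auto)
  next
    case False
    have "apply_morphism \<phi> (foldr apply_morphism ds w) = a \<frown> (x \<frown> y)"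
      using Cons.prems(1) by simp
    from descend_step[OF this Cons.prems(2-4) False]
    obtain a' x' y' r' z1' z2' t where step: "foldr apply_morphism ds w = a' \<frown> (x' \<frown> y')" "x' \<noteq> []"
      "x' \<frown> y' = r' \<frown> z1'" "y' = r' \<frown> z2'"
      and x: "mset x = mset (morph \<phi> x')"
      and r: "mset (morph \<phi> r' @ [first_letter \<phi>]) = mset (r @ t)"
      by blast
    from Cons.IH[OF step] obtain ds1 ds2 x''
      where ds: "ds = ds1 @ ds2" "x'' \<noteq> []" "mset x' = mset (morphs ds1 x'')"
        and ds2: "ds2 = [] \<or> (\<exists>a' y'. foldr apply_morphism ds2 w = a' \<frown> (x'' \<frown> y')) \<and>
                (\<exists>t. mset (morphs ds1 [0, 1]) = mset (r' @ [0, 1] @ t))"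
      by blast
    have "mset x = mset (morphs (\<phi> # ds1) x'')"
      using x mset_morph_cong[OF ds(3)] by simp
    moreover have "\<exists>t. mset (morphs (\<phi> # ds1) [0, 1]) = mset (r @ [0, 1] @ t)"
      if "mset (morphs ds1 [0, 1]) = mset (r' @ [0, 1] @ t')" for t'
    proof
      have "mset (morphs (\<phi> # ds1) [0, 1]) = mset (morph \<phi> (r' @ [0, 1] @ t'))"
        using mset_morph_cong[OF that] by simp
      also have "\<dots> = mset (morph \<phi> r' @ [first_letter \<phi>]) + mset [0, 1] + mset (morph \<phi> t')"
        using mset_morph_letters[of \<phi>] by (simp add: add_ac)
      also have "\<dots> = mset (r @ [0, 1] @ (t @ morph \<phi> t'))"
        unfolding r by simp
      finally show "mset (morphs (\<phi> # ds1) [0, 1]) = mset (r @ [0, 1] @ (t @ morph \<phi> t'))" .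
    qed
    ultimately show ?thesis
      using ds(1,2) ds2
      by - (rule exI[of _ "\<phi> # ds1"], rule exI[of _ ds2], rule exI[of _ x''], auto)
  qed
qed

text \<open>Converse of the descent: the empty match at an occurrence of \<open>x\<close> grows
  under each morphism to \<open>morph \<phi> r\<close> followed by the first letter, since whatever
  comes after \<open>r\<close> has an image starting with it. Here the length is exact.\<close>

lemma ascend:
  assumes "w = a \<frown> (x \<frown> y)"
  shows "\<exists>a' y' r z1 z2. foldr apply_morphism ds w = a' \<frown> (morphs ds x \<frown> y') \<and>
    morphs ds x \<frown> y' = r \<frown> z1 \<and> y' = r \<frown> z2 \<and> mset (r @ [0, 1]) = mset (morphs ds [0, 1])"
proof (induction ds)
  case Nil
  show ?case
    using assms by (intro exI[of _ a], intro exI[of _ y], intro exI[of _ "[]"]) auto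
next
  case (Cons \<phi> ds)
  let ?c = "first_letter \<phi>"
  obtain a' y' r z1 z2 where IH: "foldr apply_morphism ds w = a' \<frown> (morphs ds x \<frown> y')"
    "morphs ds x \<frown> y' = r \<frown> z1" "y' = r \<frown> z2"
    and r: "mset (r @ [0, 1]) = mset (morphs ds [0, 1])"
    using Cons.IH by blast
  have *: "apply_morphism \<phi> (r \<frown> z) = (morph \<phi> r @ [?c]) \<frown> suffix 1 (apply_morphism \<phi> z)" for z
    using apply_morphism_first[of \<phi> z] by (metis apply_morphism_conc conc_conc)
  have "morphs (\<phi> # ds) x \<frown> apply_morphism \<phi> y' = apply_morphism \<phi> (morphs ds x \<frown> y')"
    by (simp only: apply_morphism_conc foldr.simps o_apply)
  then have "morphs (\<phi> # ds) x \<frown> apply_morphism \<phi> y'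
      = (morph \<phi> r @ [?c]) \<frown> suffix 1 (apply_morphism \<phi> z1)"
    unfolding IH(2) * .
  moreover have "apply_morphism \<phi> y' = (morph \<phi> r @ [?c]) \<frown> suffix 1 (apply_morphism \<phi> z2)"
    unfolding IH(3) * ..
  moreover have "foldr apply_morphism (\<phi> # ds) w
      = morph \<phi> a' \<frown> (morphs (\<phi> # ds) x \<frown> apply_morphism \<phi> y')"
    using IH(1) by (simp only: apply_morphism_conc foldr.simps o_apply)
  moreover have "mset ((morph \<phi> r @ [?c]) @ [0, 1]) = mset (morphs (\<phi> # ds) [0, 1])"
  proof -
    have "mset ((morph \<phi> r @ [?c]) @ [0, 1]) = mset (morph \<phi> r) + mset [0, 1, ?c]"
      by simp
    also have "\<dots> = mset (morph \<phi> (r @ [0, 1]))"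
      unfolding mset_morph_letters[symmetric] by simp
    also have "\<dots> = mset (morphs (\<phi> # ds) [0, 1])"
      using mset_morph_cong[OF r] by simp
    finally show ?thesis .
  qed
  ultimately show ?case
    by blast
qed

section \<open>Critical exponent and repetitions of the associated sequence\<close>

text \<open>The sum of \<open>S v\<close> over the window telescopes modulo 2 to
  \<open>v i + v (i + p)\<close>.\<close>

lemma S_parity: "even (count_list (S v [i \<rightarrow> i + p]) 1) \<longleftrightarrow> v (i + p) = v i"
proof (induction p)
  case (Suc p)
  have "S v [i \<rightarrow> i + Suc p] = (S v [i \<rightarrow> i + p]) @ [v (i + p) + v (i + p + 1)]"
    by (simp add: S_def)
  with Suc show ?case
    by (cases "v i"; cases "v (i + p)"; cases "v (i + p + 1)") auto
qed simp

lemma cr_ge_period: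
  assumes "p > 0" "\<And>k. k \<le> m \<Longrightarrow> v (i + p + k) = v (i + k)"
  shows "ereal (real (p + m + 1) / real p) \<le> cr v"
proof -
  let ?L = "p + m + 1"
  define x where "x = v [i \<rightarrow> i + p]"
  define z where "z = v [i \<rightarrow> i + ?L]"
  have v: "v (i + k) = v (i + k mod p)" if "k < ?L" for k
    using that
  proof (induction k rule: less_induct)
    case (less k)
    show ?case
    proof (cases "k < p")
      case False
      then have "v (i + k) = v (i + (k - p))"
        using assms(2)[of "k - p"] less.prems by (simp add: add.assoc)
      then show ?thesis
        using less.IH[of "k - p"] False assms(1) less.prems by (simp add: le_mod_geq)
    qed simp
  qed
  have "z = prefix (length z) (x\<^sup>\<omega>)"
  proof (rule nth_equalityI)
    fix k assume "k < length z"
    then show "z ! k = prefix (length z) (x\<^sup>\<omega>) ! k"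
      using v[of k] assms(1) by (simp add: z_def x_def del: subseq_to_Suc)
  qed simp
  then have fp: "frac_power x (of_nat ?L / of_nat p) z"
    using assms(1) by (auto simp: frac_power_def x_def z_def)
  have "x \<in> language v" "z \<in> language v"
    unfolding language_def x_def z_def using le_add1 by blast+
  with fp have "ereal (real_of_rat (of_nat ?L / of_nat p)) \<le> ind v x"
    unfolding ind_def by (intro Sup_upper) blast
  also have "\<dots> \<le> cr v"
    using \<open>x \<in> language v\<close> assms(1) unfolding cr_def by (intro Sup_upper) (auto simp: x_def)
  finally show ?thesis
    by (simp add: of_rat_divide of_rat_add)
qed

text \<open>Powers no longer than two periods have exponent at most 2, hence the hypothesis on
  \<open>c\<close>; longer ones yield the \<open>m + 1\<close> coincidences of the second
  assumption.\<close>

lemma cr_le_period: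
  assumes "c \<ge> 2"
    and "\<And>i p m. \<lbrakk>p > 0; \<And>k. k \<le> m \<Longrightarrow> v (i + p + k) = v (i + k)\<rbrakk>
      \<Longrightarrow> real (p + m + 1) / real p \<le> c"
  shows "cr v \<le> ereal c"
proof -
  have "ereal (real_of_rat e) \<le> ereal c" if fp: "frac_power x e z" and z_in: "z \<in> language v" for x e z
  proof -
    define p where "p = length x"
    have p: "p > 0"
      and e: "real_of_rat e = real (length z) / real p"
      and z: "z = prefix (length z) (x\<^sup>\<omega>)"
      using fp by (auto simp: frac_power_def p_def of_rat_divide)
    obtain i j where ij: "z = v [i \<rightarrow> j]"
      using z_in by (auto simp: language_def)
    have "real (length z) / real p \<le> c"
    proof (cases "length z \<le> 2 * p")
      case True
      then have "real (length z) \<le> 2 * real p"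
        by linarith
      then have "real (length z) / real p \<le> 2"
        using p by (simp add: field_simps)
      with assms(1) show ?thesis
        by linarith
    next
      case False
      define m where "m = length z - p - 1"
      have L: "length z = p + m + 1"
        using False by (simp add: m_def)
      have zk: "v (i + k) = x ! (k mod p)" if "k < length z" for k
      proof -
        have "z ! k = v (i + k)"
          using that by (simp add: ij)
        moreover have "z ! k = x ! (k mod p)"
          by (subst z) (use that p in \<open>simp add: p_def\<close>)
        ultimately show ?thesis
          by simp
      qed
      have "v (i + p + k) = v (i + k)" if "k \<le> m" for k
        using that L zk[of "p + k"] zk[of k] by (simp add: add.assoc)
      from assms(2)[OF p this] show ?thesis
        unfolding L .
    qed
    with e show ?thesis
      by simp
  qed
  then show ?thesis
    unfolding cr_def ind_def by (auto intro!: Sup_least)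
qed

text \<open>Even parity makes \<open>v\<close> agree at both ends of \<open>x\<close>, and each of
  the \<open>length r\<close> coincidences in \<open>S v\<close> carries the agreement one letter
  further. This gives \<open>length r + 1\<close> coincidences in \<open>v\<close>.\<close>

lemma cr_ge_repetition:
  assumes u: "S v = a \<frown> (x \<frown> y)" "x \<noteq> []" "even (count_list x 1)"
    and r: "x \<frown> y = r \<frown> z1" "y = r \<frown> z2"
  shows "ereal (1 + (real (length r) + 1) / real (length x)) \<le> cr v"
proof -
  let ?i = "length a" and ?p = "length x"
  have "x = (S v [?i \<rightarrow> ?i + ?p])"
    unfolding u(1) by (rule nth_equalityI) (auto simp: conc_def)
  with u(3) have base: "v (?i + ?p) = v ?i"
    using S_parity by metis
  have per: "S v (?i + ?p + k) = S v (?i + k)" if "k < length r" for k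
  proof -
    have "S v (?i + ?p + k) = y k"
      unfolding u(1) by (simp add: conc_def)
    also have "\<dots> = (x \<frown> y) k"
      unfolding r(1) unfolding r(2) using that by simp
    also have "\<dots> = S v (?i + k)"
      unfolding u(1) by (simp add: conc_def)
    finally show ?thesis .
  qed
  have "v (?i + ?p + k) = v (?i + k)" if "k \<le> length r" for k
    using that
  proof (induction k)
    case (Suc k)
    have "v (?i + ?p + k) + v (?i + ?p + Suc k) = v (?i + k) + v (?i + Suc k)"
      using per[of k] Suc.prems by (simp add: S_def)
    moreover have "v (?i + ?p + k) = v (?i + k)"
      using Suc by simp
    ultimately show ?case
      by (metis add_left_cancel)
  qed (simp add: base)
  from cr_ge_period[OF _ this] u(2) show ?thesis
    by (simp add: field_simps)
qed

lemma cr_le_repetition: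
  assumes "c \<ge> 1"
    and "\<And>a x y r z1 z2. \<lbrakk>S v = a \<frown> (x \<frown> y); x \<noteq> []; even (count_list x 1);
      x \<frown> y = r \<frown> z1; y = r \<frown> z2\<rbrakk> \<Longrightarrow> real (length r) + 1 \<le> c * real (length x)"
  shows "cr v \<le> ereal (1 + c)"
proof (rule cr_le_period)
  fix i p m :: nat
  assume p: "p > 0" and v: "\<And>k. k \<le> m \<Longrightarrow> v (i + p + k) = v (i + k)"
  define x where "x = (S v [i \<rightarrow> i + p])"
  define y where "y = suffix (i + p) (S v)"
  \<comment> \<open>The \<open>m + 1\<close> coincidences in \<open>v\<close> give \<open>m\<close>
    coincidences in \<open>S v\<close>.\<close>
  define r where "r = prefix m y"
  have xy: "x \<frown> y = suffix i (S v)"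
    by (simp add: x_def y_def)
  then have "S v = prefix i (S v) \<frown> (x \<frown> y)"
    using prefix_suffix by metis
  moreover have "even (count_list x 1)"
    unfolding x_def S_parity using v[of 0] by simp
  moreover have "r = prefix m (x \<frown> y)"
  proof (rule nth_equalityI)
    fix k assume "k < length r"
    then have "k < m"
      by (simp add: r_def)
    then show "r ! k = prefix m (x \<frown> y) ! k"
      unfolding xy using v[of k] v[of "Suc k"] by (simp add: r_def y_def S_def)
  qed (simp add: r_def)
  then have "x \<frown> y = r \<frown> suffix m (x \<frown> y)"
    using prefix_suffix by metis
  moreover have "y = r \<frown> suffix m y"
    by (simp add: r_def)
  moreover have "x \<noteq> []"
    using p by (simp add: x_def)
  ultimately have "real (length r) + 1 \<le> c * real (length x)"
    by (intro assms(2))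
  then show "real (p + m + 1) / real p \<le> 1 + c"
    using p by (simp add: r_def x_def field_simps)
qed (use assms(1) in simp)

section \<open>Reduction to the directive sequence\<close>

text \<open>
  A state \<open>(s, t, e, f)\<close> records the lengths \<open>s\<close>, \<open>t\<close> of the images of the letters \<open>0\<close>, \<open>1\<close>
  under \<open>\<Delta>\<^sub>0 \<dots> \<Delta>\<^sub>n\<^sub>-\<^sub>1\<close>, and whether these images contain an even number of ones.
\<close>

fun advance :: "morphism \<Rightarrow> nat \<times> nat \<times> bool \<times> bool \<Rightarrow> nat \<times> nat \<times> bool \<times> bool" where
  "advance G (s, t, e, f) = (s + t, t, e = f, f)"
| "advance D (s, t, e, f) = (s, s + t, e, e = f)"

abbreviation initial_state :: "nat \<times> nat \<times> bool \<times> bool" where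
  "initial_state \<equiv> (1, 1, True, False)"

text \<open>The bounds for the factors \<open>0\<close>, \<open>1\<close>, \<open>00\<close>,
  \<open>11\<close>, in this order. A square has even parity automatically and twice the length; the
  next morphism \<open>\<phi>\<close> decides which square occurs.\<close>

fun admissible :: "real \<Rightarrow> nat \<times> nat \<times> bool \<times> bool \<Rightarrow> morphism \<Rightarrow> bool" where
  "admissible c (s, t, e, f) \<phi> \<longleftrightarrow>
     (e \<longrightarrow> real s + real t - 1 \<le> c * real s) \<and>
     (f \<longrightarrow> real s + real t - 1 \<le> c * real t) \<and>
     (\<phi> = D \<longrightarrow> real s + real t - 1 \<le> 2 * c * real s) \<and>
     (\<phi> = G \<longrightarrow> real s + real t - 1 \<le> 2 * c * real t)"

definition bounded :: "real \<Rightarrow> nat \<times> nat \<times> bool \<times> bool \<Rightarrow> morphism word \<Rightarrow> bool" where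
  "bounded c \<sigma> \<Delta> \<longleftrightarrow> (\<forall>n. admissible c (fold advance (prefix n \<Delta>) \<sigma>) (\<Delta> n))"

lemma fold_advance_initial:
  "fold advance ds initial_state =
     (length (morphs ds [0]), length (morphs ds [1]),
      even (count_list (morphs ds [0]) 1), even (count_list (morphs ds [1]) 1))"
proof (induction ds rule: rev_induct)
  case (snoc \<phi> ds)
  show ?case
    using snoc morphs_append[of ds "[0]" "[1]"] morphs_append[of ds "[1]" "[0]"]
    by (cases \<phi>) auto
qed auto

lemma length_morphs:
  "length (morphs ds x) = count_list x 0 * length (morphs ds [0]) + count_list x 1 * length (morphs ds [1])"
proof (induction x)
  case Nil
  show ?case
    by (simp add: morphs_Nil)
next
  case (Cons b x)
  then show ?case
    using morphs_append[of ds "[b]" x] by (cases b) auto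
qed

lemma count_morphs:
  "count_list (morphs ds x) d =
     count_list x 0 * count_list (morphs ds [0]) d + count_list x 1 * count_list (morphs ds [1]) d"
proof (induction x)
  case Nil
  show ?case
    by (simp add: morphs_Nil)
next
  case (Cons b x)
  then show ?case
    using morphs_append[of ds "[b]" x] by (cases b) auto
qed

section \<open>Occurrences of letters and of their squares\<close>

lemma sturmian_letter:
  assumes "sturmian w"
  obtains a y where "w = a \<frown> ([b] \<frown> y)"
proof -
  have "\<exists>i. w i = b"
  proof (rule ccontr)
    assume *: "\<nexists>i. w i = b"
    have "factors w 1 \<subseteq> {[b + 1]}"
    proof
      fix z assume "z \<in> factors w 1"
      then obtain i j where "z = w [i \<rightarrow> j]" "length z = 1"
        by (auto simp: factors_def language_def)
      then have "z = [w i]"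
        by (cases z) (auto simp: subsequence_def upt_conv_Cons dest: arg_cong[of _ _ hd])
      moreover have "w i = b + 1"
        using * by (cases "w i"; cases b) auto
      ultimately show "z \<in> {[b + 1]}"
        by simp
    qed
    then have "card (factors w 1) \<le> 1"
      using card_mono[of "{[b + 1]}"] by fastforce
    with assms show False
      by (simp add: sturmian_def)
  qed
  then obtain i where "w i = b"
    by blast
  then have "suffix i w = [b] \<frown> suffix (Suc i) w"
    using build_first[of "suffix i w"] by simp
  then have "w = prefix i w \<frown> ([b] \<frown> suffix (Suc i) w)"
    using prefix_suffix[of w i] by simp
  then show thesis
    by (rule that)
qed

text \<open>The block of the first letter is that letter alone, and the next block starts with it
  again.\<close>

lemma apply_morphism_square:
  assumes "w = a \<frown> ([first_letter \<phi>] \<frown> y)"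
  obtains a' y' where "apply_morphism \<phi> w = a' \<frown> ([first_letter \<phi>, first_letter \<phi>] \<frown> y')"
proof
  show "apply_morphism \<phi> w = morph \<phi> a \<frown> ([first_letter \<phi>, first_letter \<phi>] \<frown> suffix 1 (apply_morphism \<phi> y))"
    unfolding assms apply_morphism_conc
    using apply_morphism_first[of \<phi> y] by (simp add: letter_image_eq)
qed

lemma apply_morphism_square_letter:
  assumes "apply_morphism \<phi> w = a \<frown> ([b, b] \<frown> y)"
  shows "b = first_letter \<phi>"
proof (rule ccontr)
  assume b: "b \<noteq> first_letter \<phi>"
  have "apply_morphism \<phi> w = (a @ [b]) \<frown> ([b] \<frown> y)"
    using assms by simp
  then obtain b1 x where "morph \<phi> b1 = (a @ [b]) @ b # x"
    by (rule apply_morphism_split_list) simp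
  with b show False
    using morph_split_other by fastforce
qed

text \<open>Lifting the occurring letters and the occurring square with \<open>ascend\<close>
  produces repetitions in \<open>v\<close>, and \<open>cr v\<close> dominates their
  exponents.\<close>

lemma bounded_of_cr_le:
  assumes \<Delta>: "directive_sequence \<Delta> (S v)" and cr: "cr v \<le> ereal (1 + c)"
  shows "bounded c initial_state \<Delta>"
  unfolding bounded_def
proof
  fix n
  obtain U where U: "standard_sturmian (U n)" "S v = foldr apply_morphism (prefix n \<Delta>) (U n)" for n
    using \<Delta> unfolding directive_sequence_def by blast
  define ds where "ds = prefix n \<Delta>"
  have bound: "real (length (morphs ds [0])) + real (length (morphs ds [1])) - 1 \<le> c * real (length (morphs ds x))"
    if w: "S v = foldr apply_morphism ds w" "w = a \<frown> (x \<frown> y)"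
      and x: "x \<noteq> []" "even (count_list (morphs ds x) 1)" for w a x y
  proof -
    obtain a' y' r z1 z2 where r: "S v = a' \<frown> (morphs ds x \<frown> y')"
      "morphs ds x \<frown> y' = r \<frown> z1" "y' = r \<frown> z2" "mset (r @ [0, 1]) = mset (morphs ds [0, 1])"
      using ascend[OF w(2), of ds] w(1) by auto
    have "morphs ds x \<noteq> []"
      using length_morphs_ge[of x ds] x(1) by auto
    then have "ereal (1 + (real (length r) + 1) / real (length (morphs ds x))) \<le> ereal (1 + c)"
      using cr_ge_repetition[OF r(1) _ x(2) r(2,3)] cr by (meson order_trans)
    then have "real (length r) + 1 \<le> c * real (length (morphs ds x))"
      using \<open>morphs ds x \<noteq> []\<close> by (simp add: field_simps)
    moreover have "length r + 2 = length (morphs ds [0]) + length (morphs ds [1])"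
      using mset_eq_length[OF r(4)] length_morphs[of ds "[0, 1]"] by simp
    ultimately show ?thesis
      by linarith
  qed
  have single: "real (length (morphs ds [0])) + real (length (morphs ds [1])) - 1 \<le> c * real (length (morphs ds [b]))"
    if "even (count_list (morphs ds [b]) 1)" for b
  proof -
    obtain a y where "U n = a \<frown> ([b] \<frown> y)"
      using sturmian_letter U(1) unfolding standard_sturmian_def by metis
    then show ?thesis
      using bound[of "U n" a "[b]" y] U(2)[of n] that by (simp add: ds_def)
  qed
  have square: "real (length (morphs ds [0])) + real (length (morphs ds [1])) - 1 \<le> 2 * c * real (length (morphs ds [b]))"
    if b: "b = first_letter (\<Delta> n)" for b
  proof -
    \<comment> \<open>The square occurs in \<open>apply_morphism (\<Delta> n) (U (Suc n))\<close>;
      like \<open>U n\<close>, this word is mapped to \<open>S v\<close> by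
      \<open>ds\<close>.\<close>
    obtain a y where "U (Suc n) = a \<frown> ([b] \<frown> y)"
      using sturmian_letter U(1) unfolding standard_sturmian_def by metis
    then obtain a' y' where "apply_morphism (\<Delta> n) (U (Suc n)) = a' \<frown> ([b, b] \<frown> y')"
      unfolding b by (rule apply_morphism_square)
    moreover have "S v = foldr apply_morphism ds (apply_morphism (\<Delta> n) (U (Suc n)))"
      using U(2)[of "Suc n"] by (simp add: ds_def)
    moreover have "morphs ds [b, b] = morphs ds [b] @ morphs ds [b]"
      using morphs_append[of ds "[b]" "[b]"] by simp
    ultimately show ?thesis
      using bound[of _ a' "[b, b]" y'] by simp
  qed
  show "admissible c (fold advance (prefix n \<Delta>) initial_state) (\<Delta> n)"
    unfolding ds_def[symmetric] fold_advance_initial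
    using single square by (auto)
qed

text \<open>The descent of a repetition ends in a non-empty factor \<open>x'\<close>. If
  \<open>x'\<close> contains both letters, its image is at least as long as both letter images
  together; otherwise it is a power of one letter and falls under the four bounds.\<close>

lemma cr_le_of_bounded:
  assumes \<Delta>: "directive_sequence \<Delta> (S v)" and c: "c \<ge> 1" and bd: "bounded c initial_state \<Delta>"
    and growth: "\<And>N. \<exists>n. N < length (morphs (prefix n \<Delta>) [0]) \<and> N < length (morphs (prefix n \<Delta>) [1])"
  shows "cr v \<le> ereal (1 + c)"
proof (rule cr_le_repetition[OF c])
  fix a x y r z1 z2
  assume u: "S v = a \<frown> (x \<frown> y)" and x: "x \<noteq> []" "even (count_list x 1)"
    and r: "x \<frown> y = r \<frown> z1" "y = r \<frown> z2"
  obtain U where U: "S v = foldr apply_morphism (prefix n \<Delta>) (U n)" for n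
    using \<Delta> unfolding directive_sequence_def by blast
  \<comment> \<open>At this depth the images of both letters are longer than \<open>x\<close>, so
    the morphisms cannot be used up before the match is empty.\<close>
  obtain N where N: "length x < length (morphs (prefix N \<Delta>) [0])"
    "length x < length (morphs (prefix N \<Delta>) [1])"
    using growth by blast
  obtain ds1 ds2 x' where ds: "prefix N \<Delta> = ds1 @ ds2" "x' \<noteq> []" "mset x = mset (morphs ds1 x')"
    and ds2: "ds2 = [] \<or> (\<exists>a' y'. foldr apply_morphism ds2 (U N) = a' \<frown> (x' \<frown> y')) \<and>
                (\<exists>t. mset (morphs ds1 [0, 1]) = mset (r @ [0, 1] @ t))"
    using descend[OF _ x(1) r, of "prefix N \<Delta>" "U N" a] u U by metis
  let ?s = "length (morphs ds1 [0])" and ?t = "length (morphs ds1 [1])"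
  have count: "count_list x' 0 > 0 \<or> count_list x' 1 > 0"
    using ds(2) by (cases x'; cases "hd x'") auto
  have lx: "length x = count_list x' 0 * ?s + count_list x' 1 * ?t"
    using mset_eq_length[OF ds(3)] length_morphs by metis
  have "count_list x 1 = count_list (morphs ds1 x') 1"
    using ds(3) by (metis count_mset)
  then have ev: "even (count_list x' 0 * count_list (morphs ds1 [0]) 1
      + count_list x' 1 * count_list (morphs ds1 [1]) 1)"
    using x(2) count_morphs[of ds1 x' 1] by simp
  have "ds2 \<noteq> []"
  proof
    assume "ds2 = []"
    then have "length x < ?s" "length x < ?t"
      using N ds(1) by auto
    with lx count show False
      by (auto simp: gr0_conv_Suc)
  qed
  then obtain \<phi> ds3 where ds3: "ds2 = \<phi> # ds3"
    by (cases ds2) auto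
  define n where "n = length ds1"
  have nN: "n < N"
    using arg_cong[OF ds(1), of length] ds3 by (simp add: n_def)
  have n: "ds1 = prefix n \<Delta>"
    using arg_cong[OF ds(1), of "take n"] nN by (simp add: n_def)
  have "\<phi> = \<Delta> n"
    using arg_cong[OF ds(1), of "\<lambda>xs. xs ! n"] nN ds3 by (simp add: n_def nth_append)
  obtain a' y' t where w: "apply_morphism \<phi> (foldr apply_morphism ds3 (U N)) = a' \<frown> (x' \<frown> y')"
    and t: "mset (morphs ds1 [0, 1]) = mset (r @ [0, 1] @ t)"
    using ds2 ds3 by auto
  have lr: "real (length r) + 1 \<le> real ?s + real ?t - 1"
    using mset_eq_length[OF t] length_morphs[of ds1 "[0, 1]"] by simp
  have adm: "admissible c (?s, ?t, even (count_list (morphs ds1 [0]) 1),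
      even (count_list (morphs ds1 [1]) 1)) \<phi>"
    using bd unfolding bounded_def n \<open>\<phi> = \<Delta> n\<close> fold_advance_initial by blast
  \<comment> \<open>Here \<open>x'\<close> consists of \<open>k\<close> copies of \<open>b\<close>,
    as \<open>b + 1\<close> is the other letter. If the image of \<open>b\<close> has odd parity,
    then \<open>k\<close> is even, so \<open>b\<close> occurs doubled and must be the first letter
    of \<open>\<phi>\<close>.\<close>
  have *: "real ?s + real ?t - 1 \<le> c * real (length x)"
    if b: "count_list x' b = k" "k > 0" "count_list x' (b + 1) = 0" "length x = k * length (morphs ds1 [b])"
      "even (k * count_list (morphs ds1 [b]) 1)" for b k
  proof (cases "even (count_list (morphs ds1 [b]) 1)")
    case True
    then have "real ?s + real ?t - 1 \<le> c * real (length (morphs ds1 [b]))"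
      using adm by (cases b) auto
    also have "length (morphs ds1 [b]) \<le> length x"
      using b(2,4) by (cases k) auto
    then have "c * real (length (morphs ds1 [b])) \<le> c * real (length x)"
      using c by (intro mult_left_mono) auto
    finally show ?thesis .
  next
    case False
    have all: "d = b" if "d \<in> set x'" for d
      using b(3) that by (cases d; cases b) (auto simp: count_list_0_iff)
    have "even k"
      using b(5) False by simp
    with b(2) have "k \<ge> 2"
      by presburger
    with b(1) have "length x' \<ge> 2"
      using count_le_length order_trans by metis
    then obtain x'' where "x' = [b, b] @ x''"
      using all by (cases x'; cases "tl x'") auto
    then have "b = first_letter \<phi>"
      using w apply_morphism_square_letter[of \<phi> _ a' b "x'' \<frown> y'"] by simp
    then have "real ?s + real ?t - 1 \<le> c * (2 * real (length (morphs ds1 [b])))"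
      using adm by (cases \<phi>) auto
    also have "\<dots> \<le> c * real (length x)"
      using \<open>k \<ge> 2\<close> b(4) c by (intro mult_left_mono) (auto intro: mult_right_mono)
    finally show ?thesis .
  qed
  consider "count_list x' 0 > 0" "count_list x' 1 > 0"
    | "count_list x' 0 > 0" "count_list x' 1 = 0" | "count_list x' 0 = 0" "count_list x' 1 > 0"
    using count by auto
  then have "real ?s + real ?t - 1 \<le> c * real (length x)"
  proof cases
    case 1
    then have "?s + ?t \<le> length x"
      unfolding lx by (intro add_mono) auto
    moreover have "real (length x) \<le> c * real (length x)"
      using c mult_right_mono[of 1 c "real (length x)"] by simp
    ultimately show ?thesis
      by linarith
  next
    case 2
    then show ?thesis
      using *[of 0] lx ev by simp
  next
    case 3
    then show ?thesis
      using *[of 1] lx ev by simp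
  qed
  with lr show "real (length r) + 1 \<le> c * real (length x)"
    by linarith
qed

text \<open>Each \<open>G\<close> lengthens the image of \<open>0\<close> by the non-empty image of
  \<open>1\<close>, and each \<open>D\<close> does the same with the letters exchanged.\<close>

lemma length_morphs_gt_count:
  "count_list ds G < length (morphs ds [0])" "count_list ds D < length (morphs ds [1])"
proof (induction ds rule: rev_induct)
  case (snoc \<phi> ds)
  have pos: "morphs ds [b] \<noteq> []" for b
    using length_morphs_ge[of "[b]" ds] by auto
  {
    case 1
    show ?case
      using snoc.IH pos[of 0] pos[of 1] morphs_append[of ds "[1]" "[0]"] by (cases \<phi>) (auto simp: Suc_le_eq[symmetric])
  next
    case 2
    show ?case
      using snoc.IH pos[of 0] pos[of 1] morphs_append[of ds "[0]" "[1]"] by (cases \<phi>) (auto simp: Suc_le_eq[symmetric])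
  }
qed auto

lemma cr_eq_of_bounded:
  assumes \<Delta>: "directive_sequence \<Delta> (S v)" "\<Delta> = ds \<frown> [D, D, G, G]\<^sup>\<omega>"
    and c: "c \<ge> 1" "bounded c initial_state \<Delta>" "\<And>c'. bounded c' initial_state \<Delta> \<Longrightarrow> c \<le> c'"
  shows "cr v = ereal (1 + c)"
proof (rule antisym)
  show "cr v \<le> ereal (1 + c)"
  proof (rule cr_le_of_bounded[OF \<Delta>(1) c(1,2)])
    fix N
    have "prefix (4 * N) ([D, D, G, G]\<^sup>\<omega>) = concat (replicate N [D, D, G, G])"
    proof (induction N)
      case (Suc N)
      have "prefix (4 * Suc N) ([D, D, G, G]\<^sup>\<omega>) = prefix (4 * Suc N) ([D, D, G, G] \<frown> [D, D, G, G]\<^sup>\<omega>)"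
        using iter_unroll[of "[D, D, G, G]"] by simp
      also have "\<dots> = [D, D, G, G] @ prefix (4 * N) ([D, D, G, G]\<^sup>\<omega>)"
        by (subst prefix_conc_snd) simp_all
      also have "\<dots> = [D, D, G, G] @ concat (replicate N [D, D, G, G])"
        by (simp only: Suc)
      finally show ?case
        by (simp only: replicate.simps concat.simps)
    qed simp
    then have *: "prefix (length ds + 4 * N) \<Delta> = ds @ concat (replicate N [D, D, G, G])"
      unfolding \<Delta>(2) by (subst prefix_conc_snd) simp_all
    have "count_list (concat (replicate N [D, D, G, G])) \<phi> = 2 * N" for \<phi>
      by (induction N; cases \<phi>) auto
    then have "N \<le> count_list (prefix (length ds + 4 * N) \<Delta>) \<phi>" for \<phi>
      unfolding * by simp
    then show "\<exists>n. N < length (morphs (prefix n \<Delta>) [0]) \<and> N < length (morphs (prefix n \<Delta>) [1])"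
      using length_morphs_gt_count le_less_trans by meson
  qed
  show "ereal (1 + c) \<le> cr v"
  proof (rule ccontr)
    assume "\<not> ?thesis"
    \<comment> \<open>\<open>cr v\<close> is an extended real; a real \<open>z\<close> strictly in
      between supplies the real bound \<open>z - 1\<close>, smaller than \<open>c\<close>.\<close>
    then obtain z where z: "cr v < ereal z" "ereal z < ereal (1 + c)"
      using ereal_dense2 not_le by metis
    then have "cr v \<le> ereal (1 + (z - 1))"
      by simp
    from bounded_of_cr_le[OF \<Delta>(1) this] z(2) c(3) show False
      by fastforce
  qed
qed

section \<open>Arithmetic of the states\<close>

lemma bounded_build:
  "bounded c \<sigma> (\<phi> ## \<Delta>) \<longleftrightarrow> admissible c \<sigma> \<phi> \<and> bounded c (advance \<phi> \<sigma>) \<Delta>"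
proof -
  let ?P = "\<lambda>n. admissible c (fold advance (prefix n (\<phi> ## \<Delta>)) \<sigma>) ((\<phi> ## \<Delta>) n)"
  have "bounded c \<sigma> (\<phi> ## \<Delta>) \<longleftrightarrow> ?P 0 \<and> (\<forall>n. ?P (Suc n))"
    unfolding bounded_def using not0_implies_Suc by metis
  moreover have "prefix (Suc n) (\<phi> ## \<Delta>) = \<phi> # prefix n \<Delta>" for n
    using prefix_conc_snd[of "[\<phi>]" "Suc n" \<Delta>] by (simp del: subseq_to_Suc)
  ultimately show ?thesis
    unfolding bounded_def[of _ "advance \<phi> \<sigma>"] by (simp del: subseq_to_Suc)
qed

lemma bounded_even:
  assumes "bounded c (s, t, e, f) \<Delta>"
  shows "e \<Longrightarrow> real s + real t - 1 \<le> c * real s" "f \<Longrightarrow> real s + real t - 1 \<le> c * real t"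
proof -
  have "admissible c (fold advance (prefix 0 \<Delta>) (s, t, e, f)) (\<Delta> 0)"
    using assms unfolding bounded_def by blast
  then show "e \<Longrightarrow> real s + real t - 1 \<le> c * real s" "f \<Longrightarrow> real s + real t - 1 \<le> c * real t"
    by simp_all
qed

lemma bounded_cases:
  assumes "bounded c \<sigma> \<Delta>"
  obtains (G) \<Delta>' where "\<Delta> = G ## \<Delta>'" "admissible c \<sigma> G" "bounded c (advance G \<sigma>) \<Delta>'"
  | (D) \<Delta>' where "\<Delta> = D ## \<Delta>'" "admissible c \<sigma> D" "bounded c (advance D \<sigma>) \<Delta>'"
proof -
  have \<Delta>: "\<Delta> = \<Delta> 0 ## suffix 1 \<Delta>"
    by simp
  show thesis
    using assms that bounded_build[of c \<sigma> "\<Delta> 0" "suffix 1 \<Delta>"] \<Delta>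
    by (cases "\<Delta> 0") metis+
qed

section \<open>Directive sequences with the tail (D^2 G^2)^\<omega>\<close>

lemma DDGG_unroll: "[D, D, G, G]\<^sup>\<omega> = D ## D ## G ## G ## [D, D, G, G]\<^sup>\<omega>"
proof -
  have "[D, D, G, G]\<^sup>\<omega> = [D, D, G, G] \<frown> [D, D, G, G]\<^sup>\<omega>"
    by (rule iter_unroll) simp
  then show ?thesis
    by (simp only: build_cons conc_empty)
qed

text \<open>Lets the second form of the theorem be treated with the same periodic tail as the
  others.\<close>

lemma GGDD_eq: "[G, G, D, D]\<^sup>\<omega> = G ## G ## [D, D, G, G]\<^sup>\<omega>"
proof
  fix n
  show "[G, G, D, D]\<^sup>\<omega> n = (G ## G ## [D, D, G, G]\<^sup>\<omega>) n"
  proof (cases "n < 2")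
    case True
    then have "n = 0 \<or> n = 1"
      by auto
    then show ?thesis
      by auto
  next
    case False
    then obtain m where m: "n = Suc (Suc m)"
      by (metis One_nat_def Suc_1 less_Suc_eq_0_disj not0_implies_Suc)
    have "m mod 4 < 4"
      by simp
    then consider "m mod 4 = 0" | "m mod 4 = 1" | "m mod 4 = 2" | "m mod 4 = 3"
      by linarith
    then show ?thesis
      by cases (simp_all add: m mod_Suc)
  qed
qed

lemma nat_cases_4:
  fixes n :: nat
  obtains "n = 0" | "n = Suc 0" | "n = Suc (Suc 0)" | "n = Suc (Suc (Suc 0))" | m where "n = Suc (Suc (Suc (Suc m)))"
proof -
  have "n = 0 \<or> n = Suc 0 \<or> n = Suc (Suc 0) \<or> n = Suc (Suc (Suc 0)) \<or> (\<exists>m. n = Suc (Suc (Suc (Suc m))))"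
    by presburger
  then show thesis
    by (elim disjE exE) (rule that, assumption)+
qed

text \<open>A coinduction principle: \<open>I\<close> survives the removal of one period.\<close>

lemma DDGG_eqI:
  assumes "I \<Delta>" and step: "\<And>\<Delta>. I \<Delta> \<Longrightarrow> \<exists>\<Delta>'. \<Delta> = D ## D ## G ## G ## \<Delta>' \<and> I \<Delta>'"
  shows "\<Delta> = [D, D, G, G]\<^sup>\<omega>"
proof
  fix n
  show "\<Delta> n = [D, D, G, G]\<^sup>\<omega> n"
    using assms(1)
  proof (induction n arbitrary: \<Delta> rule: less_induct)
    case (less n)
    obtain \<Delta>' where \<Delta>': "\<Delta> = D ## D ## G ## G ## \<Delta>'" "I \<Delta>'"
      using step[OF less.prems] by blast
    show ?case
    proof (cases n rule: nat_cases_4)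
      case (5 m)
      have "\<Delta> n = \<Delta>' m"
        by (simp add: \<Delta>'(1) 5)
      also have "\<dots> = [D, D, G, G]\<^sup>\<omega> m"
        by (rule less.IH) (use \<Delta>'(2) 5 in auto)
      also have "\<dots> = [D, D, G, G]\<^sup>\<omega> n"
        by (subst (2) DDGG_unroll) (simp add: 5)
      finally show ?thesis .
    qed (simp_all add: \<Delta>'(1))
  qed
qed

text \<open>From parities odd, odd the letters \<open>D, D, G, G\<close> lead back to odd, odd with
  lengths \<open>5 * s + 2 * t\<close> and \<open>2 * s + t\<close>; the conditions in
  \<open>step\<close> are those met on the way.\<close>

lemma bounded_DDGG:
  assumes "I s t"
    and step: "\<And>s t. I s t \<Longrightarrow> admissible c (s, t, False, False) D \<and>
      admissible c (s, s + t, False, True) D \<and> admissible c (s, 2 * s + t, False, False) G \<and>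
      admissible c (3 * s + t, 2 * s + t, True, False) G \<and> I (5 * s + 2 * t) (2 * s + t)"
  shows "bounded c (s, t, False, False) ([D, D, G, G]\<^sup>\<omega>)"
  unfolding bounded_def
proof
  fix n
  let ?W = "[D, D, G, G]\<^sup>\<omega>"
  have unroll: "prefix (Suc n) ?W = D # prefix n (D ## G ## G ## ?W)"
    "prefix (Suc n) (D ## G ## G ## ?W) = D # prefix n (G ## G ## ?W)"
    "prefix (Suc n) (G ## G ## ?W) = G # prefix n (G ## ?W)"
    "prefix (Suc n) (G ## ?W) = G # prefix n ?W" for n
    using prefix_conc_snd[of "[D]" "Suc n" "D ## G ## G ## ?W"]
      prefix_conc_snd[of "[D]" "Suc n" "G ## G ## ?W"] prefix_conc_snd[of "[G]" "Suc n" "G ## ?W"]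
      prefix_conc_snd[of "[G]" "Suc n" ?W]
    by (simp_all add: DDGG_unroll[symmetric] del: subseq_to_Suc iter_nth)
  have W: "?W 0 = D" "?W (Suc 0) = D" "?W (Suc (Suc 0)) = G" "?W (Suc (Suc (Suc 0))) = G"
    by simp_all
  show "admissible c (fold advance (prefix n ?W) (s, t, False, False)) (?W n)"
    using assms(1)
  proof (induction n arbitrary: s t rule: less_induct)
    case (less n)
    note adm = step[OF less.prems]
    have sums: "s + (s + t) = 2 * s + t" "s + (s + (s + t)) = 3 * s + t"
      by simp_all
    show ?case
    proof (cases n rule: nat_cases_4)
      case (5 m)
      have "?W n = ?W m"
        by (subst DDGG_unroll) (simp add: 5)
      moreover have "fold advance (prefix n ?W) (s, t, False, False)
          = fold advance (prefix m ?W) (5 * s + 2 * t, 2 * s + t, False, False)"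
        by (simp add: 5 unroll del: subseq_to_Suc, rule arg_cong[of _ _ "fold advance _"], simp)
      moreover have "m < n" "I (5 * s + 2 * t) (2 * s + t)"
        using adm 5 by simp_all
      note less.IH[OF this]
      ultimately show ?thesis
        by (simp only:)
    qed (use adm in \<open>simp_all add: W unroll sums
          del: subseq_to_Suc admissible.simps iter_nth\<close>)
  qed
qed

text \<open>Letters come in pairs: after \<open>G, D\<close> the bound for \<open>0\<close> would
  read \<open>2 * s + 3 * t - 1 \<le> 2 * (s + t)\<close>, against \<open>1 < t\<close>, and
  \<open>D, G\<close> fails symmetrically. The inequalities in the two cases are the bounds for
  \<open>00\<close> and \<open>11\<close> before the second letter of the pair.\<close>

lemma bounded_2_odd:
  assumes "bounded 2 (s, t, False, False) \<Delta>" "1 < s" "1 < t"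
  obtains (DD) \<Delta>' where "\<Delta> = D ## D ## \<Delta>'" "t \<le> 2 * s + 1" "bounded 2 (s, 2 * s + t, False, False) \<Delta>'"
  | (GG) \<Delta>' where "\<Delta> = G ## G ## \<Delta>'" "s \<le> 2 * t + 1" "bounded 2 (s + 2 * t, t, False, False) \<Delta>'"
  using assms(1)
proof (cases rule: bounded_cases)
  case (G \<Delta>')
  then have "bounded 2 (s + t, t, True, False) \<Delta>'"
    by simp
  then show ?thesis
  proof (cases rule: bounded_cases)
    case D': (D \<Delta>'')
    then have "bounded 2 (s + t, s + t + t, True, False) \<Delta>''"
      by simp
    from bounded_even(1)[OF this] assms(2,3) show ?thesis
      by simp
  next
    case G': (G \<Delta>'')
    have "s \<le> 2 * t + 1"
      using G'(2) by simp
    moreover have "bounded 2 (s + 2 * t, t, False, False) \<Delta>''"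
      using G'(3) by (simp add: mult_2 add.assoc)
    ultimately show ?thesis
      using G(1) G'(1) GG by blast
  qed
next
  case (D \<Delta>')
  then have "bounded 2 (s, s + t, False, True) \<Delta>'"
    by simp
  then show ?thesis
  proof (cases rule: bounded_cases)
    case G': (G \<Delta>'')
    then have "bounded 2 (s + (s + t), s + t, False, True) \<Delta>''"
      by simp
    from bounded_even(2)[OF this] assms(2,3) show ?thesis
      by simp
  next
    case D': (D \<Delta>'')
    have "t \<le> 2 * s + 1"
      using D'(2) by simp
    moreover have "bounded 2 (s, 2 * s + t, False, False) \<Delta>''"
      using D'(3) by (simp add: mult_2 add.assoc)
    ultimately show ?thesis
      using D(1) D'(1) DD by blast
  qed
qed

text \<open>The inequality \<open>2 * t + 1 < s\<close> rules out \<open>G, G\<close>. After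
  \<open>D, D\<close> the length \<open>2 * s + t\<close> exceeds \<open>2 * s + 1\<close>, which
  rules out another \<open>D, D\<close>. After \<open>G, G\<close> the initial inequality holds
  again.\<close>

lemma bounded_2_DDGG:
  assumes "bounded 2 (s, t, False, False) \<Delta>" "2 * t + 1 < s" "1 < t"
  shows "\<Delta> = [D, D, G, G]\<^sup>\<omega>"
proof (rule DDGG_eqI)
  let ?I = "\<lambda>\<Delta>. \<exists>s t. bounded 2 (s, t, False, False) \<Delta> \<and> 2 * t + 1 < s \<and> 1 < t"
  show "?I \<Delta>"
    using assms by blast
  fix \<Delta> assume "?I \<Delta>"
  then obtain s t where I: "bounded 2 (s, t, False, False) \<Delta>" "2 * t + 1 < s" "1 < t"
    by blast
  obtain \<Delta>1 where 1: "\<Delta> = D ## D ## \<Delta>1" "bounded 2 (s, 2 * s + t, False, False) \<Delta>1"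
    by (rule bounded_2_odd[OF I(1)]) (use I(2,3) in auto)
  obtain \<Delta>2 where 2: "\<Delta>1 = G ## G ## \<Delta>2"
    "bounded 2 (s + 2 * (2 * s + t), 2 * s + t, False, False) \<Delta>2"
    by (rule bounded_2_odd[OF 1(2)]) (use I(2,3) in auto)
  have "2 * (2 * s + t) + 1 < s + 2 * (2 * s + t)" "1 < 2 * s + t"
    using I by auto
  with 1(1) 2 show "\<exists>\<Delta>'. \<Delta> = D ## D ## G ## G ## \<Delta>' \<and> ?I \<Delta>'"
    by blast
qed

lemma bounded_2_odd_cases:
  assumes "bounded 2 (s, t, False, False) \<Delta>" "1 < s" "1 < t"
  shows "\<Delta> = [D, D, G, G]\<^sup>\<omega> \<or> \<Delta> = G ## G ## [D, D, G, G]\<^sup>\<omega>"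
  using assms
proof (cases rule: bounded_2_odd)
  case (GG \<Delta>')
  have "\<Delta>' = [D, D, G, G]\<^sup>\<omega>"
    by (rule bounded_2_DDGG[OF GG(3)]) (use assms in auto)
  with GG show ?thesis
    by simp
next
  case (DD \<Delta>')
  have "1 < 2 * s + t"
    using assms by simp
  from DD(3) assms(2) this show ?thesis
  proof (cases rule: bounded_2_odd)
    case (GG \<Delta>'')
    have "\<Delta>'' = [D, D, G, G]\<^sup>\<omega>"
      by (rule bounded_2_DDGG[OF GG(3)]) (use assms in auto)
    with DD GG show ?thesis
      using DDGG_unroll by metis
  qed (use assms in auto)
qed

lemma bounded_2_cases:
  assumes "bounded 2 initial_state \<Delta>"
  shows "(\<exists>a1\<in>{1, 3}. \<Delta> = replicate a1 G \<frown> [D, D, G, G]\<^sup>\<omega>)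
    \<or> (\<exists>a1\<in>{1, 3}. \<Delta> = replicate a1 G \<frown> replicate 4 D \<frown> [G, G, D, D]\<^sup>\<omega>)
    \<or> (\<exists>a1\<in>{2, 4}. \<exists>a3\<in>{1, 3}. \<Delta> = replicate a1 G \<frown> [D] \<frown> replicate a3 G \<frown> [D, D, G, G]\<^sup>\<omega>)
    \<or> (\<exists>a2\<in>{1, 3}. \<Delta> = [D] \<frown> replicate a2 G \<frown> [D, D, G, G]\<^sup>\<omega>)"
proof -
  let ?A = "[D, D, G, G]\<^sup>\<omega>"
  \<comment> \<open>With the image of \<open>0\<close> even, \<open>D\<close> would leave the bound
    \<open>2 * s + t - 1 \<le> 2 * s\<close>, against \<open>1 < t\<close>; so \<open>G\<close>
    comes next and makes both parities odd. \<open>E1\<close> is the mirror image.\<close>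
  have E0: "\<Delta> = G ## ?A \<or> \<Delta> = G ## G ## G ## ?A"
    if \<Delta>: "bounded 2 (s, t, True, False) \<Delta>" and "1 < s + t" "1 < t" for s t \<Delta>
    using \<Delta>
  proof (cases rule: bounded_cases)
    case (G \<Delta>')
    then have "bounded 2 (s + t, t, False, False) \<Delta>'"
      by simp
    from bounded_2_odd_cases[OF this] that G(1) show ?thesis
      by auto
  next
    case (D \<Delta>')
    then have "bounded 2 (s, s + t, True, False) \<Delta>'"
      by simp
    from bounded_even(1)[OF this] that show ?thesis
      by simp
  qed
  have E1: "\<Delta> = D ## ?A \<or> \<Delta> = D ## G ## G ## ?A"
    if \<Delta>: "bounded 2 (s, t, False, True) \<Delta>" and "1 < s + t" "1 < s" for s t \<Delta>
    using \<Delta>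
  proof (cases rule: bounded_cases)
    case (D \<Delta>')
    then have "bounded 2 (s, s + t, False, False) \<Delta>'"
      by simp
    from bounded_2_odd_cases[OF this] that D(1) show ?thesis
      by auto
  next
    case (G \<Delta>')
    then have "bounded 2 (s + t, t, False, True) \<Delta>'"
      by simp
    from bounded_even(2)[OF this] that show ?thesis
      by simp
  qed
  \<comment> \<open>After \<open>k\<close> letters \<open>G\<close> the lengths are
    \<open>k + 1\<close> and \<open>1\<close>, and a further \<open>G\<close> needs
    \<open>k + 1 \<le> 4\<close> by the bound for \<open>11\<close>. So the first \<open>D\<close>
    comes after at most four letters \<open>G\<close>.\<close>
  consider (D) \<Delta>' where "\<Delta> = D ## \<Delta>'" "bounded 2 (1, 2, True, False) \<Delta>'"
    | (GD) \<Delta>' where "\<Delta> = G ## D ## \<Delta>'" "bounded 2 (2, 3, False, True) \<Delta>'"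
    | (GGD) \<Delta>' where "\<Delta> = G ## G ## D ## \<Delta>'" "bounded 2 (3, 4, True, False) \<Delta>'"
    | (GGGD) \<Delta>' where "\<Delta> = G ## G ## G ## D ## \<Delta>'" "bounded 2 (4, 5, False, True) \<Delta>'"
    | (GGGGD) \<Delta>' where "\<Delta> = G ## G ## G ## G ## D ## \<Delta>'" "bounded 2 (5, 6, True, False) \<Delta>'"
  proof -
    note split = bounded_cases[where c = 2]
    from assms show thesis
    proof (cases rule: split)
      case (G \<Delta>1)
      from G(3) show thesis
      proof (cases rule: split)
        case G1: (G \<Delta>2)
        from G1(3) show thesis
        proof (cases rule: split)
          case G2: (G \<Delta>3)
          from G2(3) show thesis
          proof (cases rule: split)
            case G3: (G \<Delta>4)
            from G3(3) show thesis
            proof (cases rule: split)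
              case D
              with G G1 G2 G3 show thesis
                using GGGGD by (simp add: numeral_eq_Suc)
            qed simp
          next
            case D
            with G G1 G2 show thesis
              using GGGD by (simp add: numeral_eq_Suc)
          qed
        next
          case D
          with G G1 show thesis
            using GGD by (simp add: numeral_eq_Suc)
        qed
      next
        case D
        with G show thesis
          using GD by (simp add: numeral_eq_Suc)
      qed
    next
      case D
      then show thesis
        using that(1) by (simp add: numeral_eq_Suc)
    qed
  qed
  then show ?thesis
  proof cases
    case D
    have "\<Delta>' = G ## ?A \<or> \<Delta>' = G ## G ## G ## ?A"
      using E0[OF D(2)] by simp
    then show ?thesis
      unfolding D(1) by (auto simp: numeral_eq_Suc)
  next
    case GD
    have "\<Delta>' = D ## ?A \<or> \<Delta>' = D ## G ## G ## ?A"
      using E1[OF GD(2)] by simp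
    \<comment> \<open>Two letters \<open>D\<close> before the tail, which starts with
      \<open>D, D\<close>, give the fourth power; two before \<open>G, G\<close> just complete a
      period.\<close>
    then have "\<Delta> = [G] \<frown> ?A \<or> \<Delta> = [G] \<frown> replicate 4 D \<frown> [G, G, D, D]\<^sup>\<omega>"
      using GD(1) unfolding GGDD_eq by (auto simp: numeral_eq_Suc DDGG_unroll[symmetric])
    then show ?thesis
      by auto
  next
    case GGD
    have "\<Delta>' = G ## ?A \<or> \<Delta>' = G ## G ## G ## ?A"
      using E0[OF GGD(2)] by simp
    then show ?thesis
      unfolding GGD(1) by (auto simp: numeral_eq_Suc)
  next
    case GGGD
    have "\<Delta>' = D ## ?A \<or> \<Delta>' = D ## G ## G ## ?A"
      using E1[OF GGGD(2)] by simp
    then have "\<Delta> = [G, G, G] \<frown> ?A \<or> \<Delta> = [G, G, G] \<frown> replicate 4 D \<frown> [G, G, D, D]\<^sup>\<omega>"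
      using GGGD(1) unfolding GGDD_eq by (auto simp: numeral_eq_Suc DDGG_unroll[symmetric])
    then show ?thesis
      by (auto simp: numeral_eq_Suc)
  next
    case GGGGD
    have "\<Delta>' = G ## ?A \<or> \<Delta>' = G ## G ## G ## ?A"
      using E0[OF GGGGD(2)] by simp
    then show ?thesis
      unfolding GGGGD(1) by (auto simp: numeral_eq_Suc)
  qed
qed

text \<open>After the first \<open>D\<close> of each period the image of \<open>1\<close> is even,
  which gives \<open>s - 1 \<le> (c - 1) * (s + t)\<close>. As
  \<open>(s + t)^2 = 2 * s^2 - Q s t\<close> with \<open>Q\<close> constant and \<open>s\<close>
  unbounded, \<open>0 \<le> c - 1 < 1 / sqrt 2\<close> is impossible.\<close>

lemma bounded_DDGG_limit:
  assumes "bounded c (s, t, False, False) ([D, D, G, G]\<^sup>\<omega>)" "1 \<le> s" "1 \<le> t"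
  shows "1 + 1 / sqrt 2 \<le> c"
proof (rule ccontr)
  let ?W = "[D, D, G, G]\<^sup>\<omega>"
  define Q where "Q s t = (real s)\<^sup>2 - 2 * real s * real t - (real t)\<^sup>2" for s t
  define d where "d = c - 1"
  assume "\<not> ?thesis"
  then have d: "d < 1 / sqrt 2"
    by (simp add: d_def)
  have orbit: "\<exists>s' t'. bounded c (s', t', False, False) ?W \<and> k < s' \<and> 1 \<le> t' \<and> Q s' t' = Q s t" for k
  proof (induction k)
    case 0
    have "bounded c (s, t, False, False) ?W \<and> 0 < s \<and> 1 \<le> t \<and> Q s t = Q s t"
      using assms by (simp del: iter_nth)
    then show ?case
      by blast
  next
    case (Suc k)
    then obtain s' t' where IH: "bounded c (s', t', False, False) ?W" "k < s'" "1 \<le> t'" "Q s' t' = Q s t"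
      by blast
    have "bounded c (fold advance [D, D, G, G] (s', t', False, False)) ?W"
      using IH(1) by (subst (asm) DDGG_unroll) (simp only: bounded_build fold.simps o_apply id_apply)
    then have "bounded c (5 * s' + 2 * t', 2 * s' + t', False, False) ?W"
      by (rule subst[of _ _ "\<lambda>\<sigma>. bounded c \<sigma> ?W", rotated]) simp
    moreover have "Q (5 * s' + 2 * t') (2 * s' + t') = Q s t"
      unfolding IH(4)[symmetric] by (simp add: Q_def power2_eq_square algebra_simps)
    ultimately show ?case
      using IH(2,3)
      by - (rule exI[of _ "5 * s' + 2 * t'"], rule exI[of _ "2 * s' + t'"], simp del: iter_nth)
  qed
  have ev: "real s' - 1 \<le> d * (real s' + real t')" if "bounded c (s', t', False, False) ?W" for s' t'
    using that by (subst (asm) DDGG_unroll) (simp add: bounded_build d_def algebra_simps)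
  have "0 \<le> d"
  proof -
    have "0 \<le> d * (real s + real t)"
      using ev[OF assms(1)] assms(2) by linarith
    with assms(2,3) show ?thesis
      by (simp add: zero_le_mult_iff)
  qed
  then have "d\<^sup>2 < (1 / sqrt 2)\<^sup>2"
    using d by (intro power_strict_mono) auto
  then have d2: "d\<^sup>2 < 1 / 2"
    by (simp add: power_divide)
  \<comment> \<open>For \<open>x\<close> beyond this threshold, \<open>(1 - 2 * d^2) * x^2\<close>
    exceeds \<open>(2 + |Q s t|) * x\<close>.\<close>
  obtain k :: nat where k: "(2 + \<bar>Q s t\<bar>) / (1 - 2 * d\<^sup>2) < real k"
    using reals_Archimedean2 by blast
  obtain s' t' where o: "bounded c (s', t', False, False) ?W" "k < s'" "1 \<le> t'" "Q s' t' = Q s t"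
    using orbit by blast
  define x where "x = real s'"
  have x1: "1 \<le> x"
    using o(2) by (simp add: x_def)
  have "(x - 1)\<^sup>2 \<le> (d * (x + real t'))\<^sup>2"
    using ev[OF o(1)] x1 by (intro power_mono) (simp_all add: x_def)
  also have "\<dots> = d\<^sup>2 * (2 * x\<^sup>2 - Q s t)"
    unfolding o(4)[symmetric] by (simp add: Q_def x_def power2_eq_square algebra_simps)
  finally have "(1 - 2 * d\<^sup>2) * x\<^sup>2 \<le> 2 * x - 1 - d\<^sup>2 * Q s t"
    by (simp add: power2_eq_square algebra_simps)
  also have "- (d\<^sup>2 * Q s t) \<le> \<bar>Q s t\<bar>"
  proof -
    have "- (d\<^sup>2 * Q s t) \<le> d\<^sup>2 * \<bar>Q s t\<bar>"
      using mult_left_mono[of "- Q s t" "\<bar>Q s t\<bar>" "d\<^sup>2"] by simp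
    also have "\<dots> \<le> 1 * \<bar>Q s t\<bar>"
      using d2 by (intro mult_right_mono) auto
    finally show ?thesis
      by simp
  qed
  then have "2 * x - 1 - d\<^sup>2 * Q s t \<le> (2 + \<bar>Q s t\<bar>) * x"
    using x1 mult_left_mono[of 1 x "\<bar>Q s t\<bar>"] by (simp add: algebra_simps)
  finally have "(1 - 2 * d\<^sup>2) * x * x \<le> (2 + \<bar>Q s t\<bar>) * x"
    unfolding power2_eq_square[of x] mult.assoc .
  then have "(1 - 2 * d\<^sup>2) * x \<le> 2 + \<bar>Q s t\<bar>"
    using x1 by (simp only: mult_le_cancel_right_pos)
  moreover have "2 + \<bar>Q s t\<bar> < (1 - 2 * d\<^sup>2) * real k"
    using k d2 by (simp add: field_simps)
  moreover have "(1 - 2 * d\<^sup>2) * real k \<le> (1 - 2 * d\<^sup>2) * x"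
    using o(2) d2 by (intro mult_left_mono) (auto simp: x_def)
  ultimately show False
    by linarith
qed

text \<open>The starting states are those reached after \<open>G\<close> and after
  \<open>G, G, G\<close>; there \<open>Q\<close> is \<open>-1\<close> and \<open>7\<close>. The
  limit value bounds the whole orbit because the \<open>- 1\<close> in \<open>s + t - 1\<close>
  outweighs these constants.\<close>

lemma bounded_DDGG_sqrt:
  assumes "s = 2 \<or> s = 4"
  shows "bounded (1 + 1 / sqrt 2) (s, 1, False, False) ([D, D, G, G]\<^sup>\<omega>)"
proof -
  define c where "c = 1 + 1 / sqrt 2"
  define Q where "Q x y = x\<^sup>2 - 2 * x * y - y\<^sup>2" for x y :: real
  let ?I = "\<lambda>s t. (Q (real s) (real t) = -1 \<and> 2 \<le> s \<or> Q (real s) (real t) = 7 \<and> 4 \<le> s) \<and> 1 \<le> t \<and> t \<le> s"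
  have c: "3 / 2 \<le> c"
    using real_sqrt_le_mono[of 2 4] by (simp add: c_def field_simps)
  have sqrt: "b \<le> (c - 1) * a" if "2 * b\<^sup>2 \<le> a\<^sup>2" "0 \<le> a" for a b :: real
  proof -
    have "sqrt 2 * b \<le> a"
      by (rule power2_le_imp_le) (use that in \<open>simp_all add: power_mult_distrib\<close>)
    then show ?thesis
      by (simp add: c_def field_simps)
  qed
  have "bounded c (s, 1, False, False) ([D, D, G, G]\<^sup>\<omega>)"
  proof (rule bounded_DDGG[where I = ?I])
    show "?I s 1"
      using assms by (auto simp: Q_def)
  next
    fix s t assume I: "?I s t"
    define x y where "x = real s" and "y = real t"
    have Q: "Q x y = -1 \<or> Q x y = 7 \<and> 4 \<le> x" and xy: "2 \<le> x" "1 \<le> y" "y \<le> x"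
      using I by (auto simp: x_def y_def)
    \<comment> \<open>Right side minus left side is \<open>4 * x - 2 - Q x y\<close> here, and
      \<open>Q x y + 8 * x + 4 * y - 2\<close> in the second estimate below.\<close>
    have "2 * (x - 1)\<^sup>2 \<le> (x + y)\<^sup>2"
      using Q xy by (auto simp: Q_def power2_eq_square algebra_simps)
    then have ev1: "x - 1 \<le> (c - 1) * (x + y)"
      by (rule sqrt) (use xy in simp)
    have "2 * (2 * x + y - 1)\<^sup>2 \<le> (3 * x + y)\<^sup>2"
      using Q xy by (auto simp: Q_def power2_eq_square algebra_simps)
    then have ev2: "2 * x + y - 1 \<le> (c - 1) * (3 * x + y)"
      by (rule sqrt) (use xy in simp)
    have c': "3 * z \<le> 2 * c * z" if "0 \<le> z" for z
      using mult_right_mono[of 3 "2 * c" z] c that by simp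
    have "Q (5 * x + 2 * y) (2 * x + y) = Q x y"
      by (simp add: Q_def power2_eq_square algebra_simps)
    then have I': "?I (5 * s + 2 * t) (2 * s + t)"
      using I by (auto simp: x_def y_def)
    have "x + y - 1 \<le> 2 * c * x" "2 * x + y - 1 \<le> 2 * c * x"
      by (rule order_trans[OF _ c'], use xy in simp, use xy in simp)+
    moreover have "3 * x + y - 1 \<le> 2 * c * (2 * x + y)" "5 * x + 2 * y - 1 \<le> 2 * c * (2 * x + y)"
      by (rule order_trans[OF _ c'], use xy in simp, use xy in simp)+
    ultimately have "admissible c (s, t, False, False) D \<and>
      admissible c (s, s + t, False, True) D \<and> admissible c (s, 2 * s + t, False, False) G \<and>
      admissible c (3 * s + t, 2 * s + t, True, False) G"
      using ev1 ev2 unfolding x_def y_def by (simp add: algebra_simps)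
    with I' show "admissible c (s, t, False, False) D \<and>
      admissible c (s, s + t, False, True) D \<and> admissible c (s, 2 * s + t, False, False) G \<and>
      admissible c (3 * s + t, 2 * s + t, True, False) G \<and> ?I (5 * s + 2 * t) (2 * s + t)"
      by blast
  qed
  then show ?thesis
    by (simp add: c_def)
qed

text \<open>The hypothesis is the bound for \<open>00\<close> before the second \<open>D\<close> of
  a period; it implies the other bounds and itself one period later.\<close>

lemma bounded_DDGG_2:
  assumes "t \<le> 2 * s + 1"
  shows "bounded 2 (s, t, False, False) ([D, D, G, G]\<^sup>\<omega>)"
proof (rule bounded_DDGG[where I = "\<lambda>s t. t \<le> 2 * s + 1"])
  fix s t :: nat
  assume "t \<le> 2 * s + 1"
  moreover from this have "real t \<le> 2 * real s + 1"
    by linarith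
  ultimately show "admissible 2 (s, t, False, False) D \<and>
      admissible 2 (s, s + t, False, True) D \<and> admissible 2 (s, 2 * s + t, False, False) G \<and>
      admissible 2 (3 * s + t, 2 * s + t, True, False) G \<and> 2 * s + t \<le> 2 * (5 * s + 2 * t) + 1"
    by simp
qed (rule assms)

theorem proposition34:
  fixes v u :: "bit word" and \<Delta> :: "morphism word"
  assumes "cs_rote v"
    and "u = S v"
    and "standard_sturmian u"
    and "directive_sequence \<Delta> u"
  shows "(cr v \<le> 3 \<longrightarrow>
            (\<exists>a1\<in>{1, 3}. \<Delta> = replicate a1 G \<frown> [D, D, G, G]\<^sup>\<omega>)
          \<or> (\<exists>a1\<in>{1, 3}. \<Delta> = replicate a1 G \<frown> replicate 4 D \<frown> [G, G, D, D]\<^sup>\<omega>)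
          \<or> (\<exists>a1\<in>{2, 4}. \<exists>a3\<in>{1, 3}.
               \<Delta> = replicate a1 G \<frown> [D] \<frown> replicate a3 G \<frown> [D, D, G, G]\<^sup>\<omega>)
          \<or> (\<exists>a2\<in>{1, 3}. \<Delta> = [D] \<frown> replicate a2 G \<frown> [D, D, G, G]\<^sup>\<omega>))
       \<and> (\<forall>a1\<in>{1, 3}. \<Delta> = replicate a1 G \<frown> [D, D, G, G]\<^sup>\<omega>
             \<longrightarrow> cr v = ereal (2 + 1 / sqrt 2))
       \<and> (\<forall>a1\<in>{1, 3}. \<Delta> = replicate a1 G \<frown> replicate 4 D \<frown> [G, G, D, D]\<^sup>\<omega>
             \<longrightarrow> cr v = 3)
       \<and> (\<forall>a1\<in>{2, 4}. \<forall>a3\<in>{1, 3}.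
             \<Delta> = replicate a1 G \<frown> [D] \<frown> replicate a3 G \<frown> [D, D, G, G]\<^sup>\<omega>
             \<longrightarrow> cr v = 3)
       \<and> (\<forall>a2\<in>{1, 3}. \<Delta> = [D] \<frown> replicate a2 G \<frown> [D, D, G, G]\<^sup>\<omega>
             \<longrightarrow> cr v = 3)"
proof -
  let ?W = "[D, D, G, G]\<^sup>\<omega>"
  have \<Delta>: "directive_sequence \<Delta> (S v)"
    using assms(2,4) by simp
  \<comment> \<open>Minimality of 2 comes from the preperiod: in the third and fourth form the state
    right after the first \<open>D\<close> has \<open>s + t - 1 = 2 * s\<close> with the image of
    \<open>0\<close> even; in the second form \<open>s + t - 1 = 4 * s\<close> before the fourth
    \<open>D\<close>, where \<open>00\<close> occurs.\<close>
  have cr_3: "cr v = 3"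
    if "\<Delta> = ds \<frown> ?W" "bounded 2 initial_state (ds \<frown> ?W)"
      "\<And>c. bounded c initial_state (ds \<frown> ?W) \<Longrightarrow> 2 \<le> c" for ds
    using cr_eq_of_bounded[OF \<Delta> that(1), of 2] that(2,3) unfolding that(1)[symmetric] by simp
  note simps = numeral_eq_Suc bounded_build bounded_DDGG_2
  show ?thesis
  proof (intro conjI impI ballI)
    assume "cr v \<le> 3"
    then have "bounded 2 initial_state \<Delta>"
      by (intro bounded_of_cr_le[OF \<Delta>]) simp
    then show "(\<exists>a1\<in>{1, 3}. \<Delta> = replicate a1 G \<frown> ?W)
        \<or> (\<exists>a1\<in>{1, 3}. \<Delta> = replicate a1 G \<frown> replicate 4 D \<frown> [G, G, D, D]\<^sup>\<omega>)
        \<or> (\<exists>a1\<in>{2, 4}. \<exists>a3\<in>{1, 3}. \<Delta> = replicate a1 G \<frown> [D] \<frown> replicate a3 G \<frown> ?W)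
        \<or> (\<exists>a2\<in>{1, 3}. \<Delta> = [D] \<frown> replicate a2 G \<frown> ?W)"
      by (rule bounded_2_cases)
  next
    fix a1 :: nat
    assume a1: "a1 \<in> {1, 3}" and \<Delta>_eq: "\<Delta> = replicate a1 G \<frown> ?W"
    let ?c = "1 + 1 / sqrt 2"
    have c: "3 / 2 \<le> ?c"
      using real_sqrt_le_mono[of 2 4] by (simp add: field_simps)
    have "bounded ?c (2, 1, False, False) ?W" "bounded ?c (4, 1, False, False) ?W"
      using bounded_DDGG_sqrt[of 2] bounded_DDGG_sqrt[of 4] by simp_all
    with a1 c have "bounded ?c initial_state \<Delta>"
      unfolding \<Delta>_eq by (auto simp: numeral_eq_Suc bounded_build)
    moreover have "?c \<le> c'" if "bounded c' initial_state \<Delta>" for c'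
    proof -
      have "bounded c' (2, 1, False, False) ?W \<or> bounded c' (4, 1, False, False) ?W"
        using that a1 unfolding \<Delta>_eq by (auto simp: numeral_eq_Suc bounded_build)
      then show ?thesis
        by (auto dest!: bounded_DDGG_limit)
    qed
    ultimately have "cr v = ereal (1 + ?c)"
      using c by (intro cr_eq_of_bounded[OF \<Delta> \<Delta>_eq]) auto
    then show "cr v = ereal (2 + 1 / sqrt 2)"
      by (simp add: add.assoc[symmetric])
  next
    fix a1 :: nat
    assume "a1 \<in> {1, 3}" and "\<Delta> = replicate a1 G \<frown> replicate 4 D \<frown> [G, G, D, D]\<^sup>\<omega>"
    then show "cr v = 3"
      by (intro cr_3[of "replicate a1 G @ replicate 4 D @ [G, G]"])
        (auto simp: simps GGDD_eq)
  next
    fix a1 a3 :: nat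
    assume "a1 \<in> {2, 4}" "a3 \<in> {1, 3}" and "\<Delta> = replicate a1 G \<frown> [D] \<frown> replicate a3 G \<frown> ?W"
    then show "cr v = 3"
      by (intro cr_3[of "replicate a1 G @ [D] @ replicate a3 G"]) (auto simp: simps)
  next
    fix a2 :: nat
    assume "a2 \<in> {1, 3}" and "\<Delta> = [D] \<frown> replicate a2 G \<frown> ?W"
    then show "cr v = 3"
      by (intro cr_3[of "[D] @ replicate a2 G"]) (auto simp: simps)
  qed
qed

end
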